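(* Let $K$ be a field with a fixed algebraic closure $\overline{K}$, let $X$ be an indeterminate, and let $v$ be a valuation on $\overline{K}(X)$ such that the extension $(K(X)|K,v)$ is valuation transcendental. Let $(a,\gamma)$ be a minimal pair of definition for $v$ over $K$ and fix an extension of $v$ to $\overline{K(X)}$. Then $$(K(a)\cap K^r)^h\subseteq IC(K(X)|K,v)\subseteq K(a)^h.$$
   Context: Valuations are Krull valuations (of arbitrary rank), written additively, with $v0=\infty$. For a valued field $(F,v)$, $vF$ denotes the value group and $Fv$ the residue field; restrictions of $v$ to subfields are again denoted by $v$. The extension $(K(X)|K,v)$ is called valuation transcendental if $\dim_{\mathbb{Q}}\big(\mathbb{Q}\otimes_{\mathbb{Z}}(vK(X)/vK)\big)+\mathrm{trdeg}[K(X)v:Kv]=1$ (in general the left side is at most $1$). A pair $(a,\gamma)\in\overline{K}\times v\overline{K}(X)$ is a minimal pair of definition for $v$ over $K$ if (MP1) $v(X-a)=\gamma=\max\{v(X-c)\mid c\in\overline{K}\}$, and (MP2) for all $b\in\overline{K}$, $v(a-b)\geq\gamma$ implies $[K(b):K]\geq[K(a):K]$. $\overline{K(X)}$ is an algebraic closure of $K(X)$ containing $\overline{K}(X)$, and the fixed extension of $v$ to it is again denoted by $v$. For a subfield $F$ of $\overline{K(X)}$, let $F^{\mathrm{sep}}$ be its separable-algebraic closure and $\overline{F}$ its algebraic closure in $\overline{K(X)}$. The henselization $F^h$ (with respect to the fixed $v$) is the absolute decomposition field, i.e. the fixed field in $F^{\mathrm{sep}}$ of $\{\sigma\in\mathrm{Gal}(\overline{F}|F)\mid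 v\circ\sigma=v\text{ on }F^{\mathrm{sep}}\}$. The absolute ramification field $F^r$ is the fixed field in $F^{\mathrm{sep}}$ of $\{\sigma\in\mathrm{Gal}(\overline{F}|F)\mid v(\sigma c-c)>vc\text{ for all }c\in F^{\mathrm{sep}}\setminus\{0\}\}$. Here $\mathrm{Gal}(\overline{F}|F)$ is the group of all automorphisms of $\overline{F}$ over $F$. The implicit constant field is $IC(K(X)|K,v):=\overline{K}\cap K(X)^h$. *)

theory Defs
  imports
    "HOL-Algebra.Algebraic_Closure_Type"
    "HOL-Algebra.Generated_Fields"
    "HOL-Algebra.Free_Abelian_Groups"
    "HOL-Library.Extended"
    "Jordan_Normal_Form.Missing_VectorSpace"
begin

text \<open>
  Everything takes place inside one algebraically closed field, the type \<open>'a\<close>, which plays the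
  role of the algebraic closure of \<open>K(X)\<close>; all other fields are subsets of it. The abbreviation
  \<open>\<Omega>\<close> is this field as a ring record, so that the notions of HOL-Algebra apply to its subfields. The indeterminate is called \<open>x\<close>, since HOL-Algebra
  reserves \<open>X\<close> as notation.
\<close>

abbreviation Omega :: "'a::field ring" (\<open>\<Omega>\<close>)
  where "\<Omega> \<equiv> ring_of_type_algebra"

definition adjoin :: "'a::field set \<Rightarrow> 'a \<Rightarrow> 'a set"
  where "adjoin F a = generate_field \<Omega> (insert a F)"

text \<open>\<open>ring.dim\<close> is a definite description, so \<open>[E : F]\<close> is meaningful only for finite extensions.\<close>

definition ext_degree :: "'a::field set \<Rightarrow> 'a set \<Rightarrow> nat"
  where "ext_degree E F = (ring.dim \<Omega> over F) E"

definition alg_cl :: "'a::field set \<Rightarrow> 'a set"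
  where "alg_cl F = {x. (ring.algebraic \<Omega> over F) x}"

text \<open>
  HOL-Algebra represents polynomials as lists with the leading coefficient first.
\<close>

definition min_poly :: "'a::field set \<Rightarrow> 'a \<Rightarrow> 'a poly"
  where "min_poly F x = Poly (rev (ring.Irr \<Omega> F x))"

text \<open>
  A polynomial is separable if it has only simple roots in an algebraic closure; as \<open>'a\<close> is
  algebraically closed, this is \<^const>\<open>rsquarefree\<close> over \<open>'a\<close>.
\<close>

definition sep_cl :: "'a::alg_closed_field set \<Rightarrow> 'a set"
  where "sep_cl F = {x \<in> alg_cl F. rsquarefree (min_poly F x)}"

text \<open>
  The automorphisms of the algebraic closure of \<open>F\<close> over \<open>F\<close>; the values of such a function
  outside \<open>alg_cl F\<close> are irrelevant.
\<close>

definition Gal :: "'a::field set \<Rightarrow> ('a \<Rightarrow> 'a) set"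
  where "Gal F = {\<sigma> \<in> ring_iso (\<Omega>\<lparr>carrier := alg_cl F\<rparr>) (\<Omega>\<lparr>carrier := alg_cl F\<rparr>). \<forall>x\<in>F. \<sigma> x = x}"


section \<open>Valuations\<close>

text \<open>
  The type \<^typ>\<open>'g extended\<close> also contains \<open>-\<infinity>\<close>, which is not allowed as a value. The value group
  is a subgroup of the arbitrary ordered abelian group \<open>'g\<close>.
\<close>

definition valuation :: "('a::field \<Rightarrow> 'g::linordered_ab_group_add extended) \<Rightarrow> bool"
  where "valuation v \<longleftrightarrow>
    (\<forall>x. v x \<noteq> -\<infinity>) \<and>
    (\<forall>x. v x = \<infinity> \<longleftrightarrow> x = 0) \<and>
    (\<forall>x y. v (x * y) = v x + v y) \<and>
    (\<forall>x y. min (v x) (v y) \<le> v (x + y))"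

definition value_group ::
    "('a::field \<Rightarrow> 'g::linordered_ab_group_add extended) \<Rightarrow> 'a set \<Rightarrow> 'g monoid"
  where "value_group v F =
    \<lparr>carrier = {g. \<exists>x\<in>F. v x = Fin g}, monoid.mult = (+), one = 0\<rparr>"

definition val_ring ::
    "('a::field \<Rightarrow> 'g::linordered_ab_group_add extended) \<Rightarrow> 'a set \<Rightarrow> 'a ring"
  where "val_ring v F = \<Omega>\<lparr>carrier := {x\<in>F. 0 \<le> v x}\<rparr>"

definition max_ideal ::
    "('a::field \<Rightarrow> 'g::linordered_ab_group_add extended) \<Rightarrow> 'a set \<Rightarrow> 'a set"
  where "max_ideal v F = {x\<in>F. 0 < v x}"

definition residue_field ::
    "('a::field \<Rightarrow> 'g::linordered_ab_group_add extended) \<Rightarrow> 'a set \<Rightarrow> 'a set ring"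
  where "residue_field v F = val_ring v F Quot max_ideal v F"

text \<open>For \<open>E \<subseteq> F\<close>, the canonical copy of the residue field of \<open>E\<close> inside that of \<open>F\<close>.\<close>

definition residue_subfield ::
    "('a::field \<Rightarrow> 'g::linordered_ab_group_add extended) \<Rightarrow> 'a set \<Rightarrow> 'a set \<Rightarrow> 'a set set"
  where "residue_subfield v F E =
    (\<lambda>x. max_ideal v F +>\<^bsub>val_ring v F\<^esub> x) ` carrier (val_ring v E)"


section \<open>Transcendence degree\<close>

text \<open>A monomial in the variables \<open>B\<close> is given by its finitely supported exponent function.\<close>

definition monomials :: "'b set \<Rightarrow> ('b \<Rightarrow> nat) set"
  where "monomials B = {m. finite {b. m b \<noteq> 0} \<and> {b. m b \<noteq> 0} \<subseteq> B}"

definition monomial_eval :: "('b, 'm) ring_scheme \<Rightarrow> ('b \<Rightarrow> nat) \<Rightarrow> 'b"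
  where "monomial_eval R m = (\<Otimes>\<^bsub>R\<^esub>b\<in>{b. m b \<noteq> 0}. b [^]\<^bsub>R\<^esub> m b)"

definition alg_independent :: "('b, 'm) ring_scheme \<Rightarrow> 'b set \<Rightarrow> 'b set \<Rightarrow> bool"
  where "alg_independent R k B \<longleftrightarrow> B \<subseteq> carrier R \<and>
    (\<forall>M c. finite M \<and> M \<subseteq> monomials B \<and> c \<in> M \<rightarrow> k \<and>
       (\<Oplus>\<^bsub>R\<^esub>m\<in>M. c m \<otimes>\<^bsub>R\<^esub> monomial_eval R m) = \<zero>\<^bsub>R\<^esub> \<longrightarrow> (\<forall>m\<in>M. c m = \<zero>\<^bsub>R\<^esub>))"

definition transcendence_basis :: "('b, 'm) ring_scheme \<Rightarrow> 'b set \<Rightarrow> 'b set \<Rightarrow> bool"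
  where "transcendence_basis R k B \<longleftrightarrow> alg_independent R k B \<and>
    (\<forall>x\<in>carrier R. (ring.algebraic R over (generate_field R (k \<union> B))) x)"

text \<open>The field \<open>R\<close> has finite transcendence degree \<open>n\<close> over its subfield \<open>k\<close>.\<close>

definition has_trdeg :: "('b, 'm) ring_scheme \<Rightarrow> 'b set \<Rightarrow> nat \<Rightarrow> bool"
  where "has_trdeg R k n \<longleftrightarrow> (\<exists>B. transcendence_basis R k B \<and> finite B \<and> card B = n)"


section \<open>Rational rank\<close>

text \<open>
  The tensor product of \<open>\<rat>\<close> and an abelian group \<open>G\<close> over the integers, as the free abelian group
  on \<open>\<rat> \<times> G\<close> modulo the bilinearity relations. (The relations \<open>nq \<otimes> x = q \<otimes> nx\<close> for integers
  \<open>n\<close> follow from biadditivity.)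
\<close>

definition tensor_free :: "('c, 'm) monoid_scheme \<Rightarrow> ((rat \<times> 'c) \<Rightarrow>\<^sub>0 int) monoid"
  where "tensor_free G = free_Abelian_group (UNIV \<times> carrier G)"

definition tensor_rels :: "('c, 'm) monoid_scheme \<Rightarrow> ((rat \<times> 'c) \<Rightarrow>\<^sub>0 int) set"
  where "tensor_rels G = generate (tensor_free G)
    ({frag_of (p + q, x) - frag_of (p, x) - frag_of (q, x) | p q x. x \<in> carrier G} \<union>
     {frag_of (p, x \<otimes>\<^bsub>G\<^esub> y) - frag_of (p, x) - frag_of (p, y) | p x y.
        x \<in> carrier G \<and> y \<in> carrier G})"

text \<open>
  The scalar \<open>r\<close> acts by \<open>r \<cdot> (q \<otimes> x) = rq \<otimes> x\<close>. The multiplicative part of the record is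
  not used by \<^locale>\<open>vectorspace\<close>.
\<close>

definition rat_tensor ::
    "('c, 'm) monoid_scheme \<Rightarrow> (rat, ((rat \<times> 'c) \<Rightarrow>\<^sub>0 int) set) module"
  where "rat_tensor G =
    \<lparr>carrier = carrier (tensor_free G Mod tensor_rels G),
     monoid.mult = undefined, one = undefined,
     ring.zero = \<one>\<^bsub>tensor_free G Mod tensor_rels G\<^esub>,
     ring.add = (\<otimes>\<^bsub>tensor_free G Mod tensor_rels G\<^esub>),
     module.smult = (\<lambda>r C. \<Union>c\<in>C. tensor_rels G #>\<^bsub>tensor_free G\<^esub>
                        frag_extend (\<lambda>(q, x). frag_of (r * q, x)) c)\<rparr>"

text \<open>The rational rank of \<open>G\<close> is finite and equal to \<open>n\<close>.\<close>

definition has_rat_rank :: "('c, 'm) monoid_scheme \<Rightarrow> nat \<Rightarrow> bool"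
  where "has_rat_rank G n \<longleftrightarrow>
    vectorspace.fin_dim (\<Omega> :: rat ring) (rat_tensor G) \<and>
    vectorspace.dim (\<Omega> :: rat ring) (rat_tensor G) = n"


section \<open>Minimal pairs and implicit constant fields\<close>

definition valuation_transcendental ::
    "('a::field \<Rightarrow> 'g::linordered_ab_group_add extended) \<Rightarrow> 'a set \<Rightarrow> 'a \<Rightarrow> bool"
  where "valuation_transcendental v K x \<longleftrightarrow>
    (\<exists>r t. has_rat_rank (value_group v (adjoin K x) Mod carrier (value_group v K)) r \<and>
           has_trdeg (residue_field v (adjoin K x)) (residue_subfield v (adjoin K x) K) t \<and>
           r + t = 1)"

definition minimal_pair ::
    "('a::field \<Rightarrow> 'g::linordered_ab_group_add extended) \<Rightarrow> 'a set \<Rightarrow> 'a \<Rightarrow> 'a \<Rightarrow> 'g \<Rightarrow> bool"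
  where "minimal_pair v K x a \<gamma> \<longleftrightarrow>
    a \<in> alg_cl K \<and> \<gamma> \<in> carrier (value_group v (adjoin (alg_cl K) x)) \<and>
    v (x - a) = Fin \<gamma> \<and> (\<forall>c\<in>alg_cl K. v (x - c) \<le> Fin \<gamma>) \<and>
    (\<forall>b\<in>alg_cl K. Fin \<gamma> \<le> v (a - b) \<longrightarrow>
       ext_degree (adjoin K a) K \<le> ext_degree (adjoin K b) K)"

definition henselization ::
    "('a::alg_closed_field \<Rightarrow> 'g::linordered_ab_group_add extended) \<Rightarrow> 'a set \<Rightarrow> 'a set"
  where "henselization v F =
    {x \<in> sep_cl F. \<forall>\<sigma>\<in>Gal F. (\<forall>y\<in>sep_cl F. v (\<sigma> y) = v y) \<longrightarrow> \<sigma> x = x}"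

definition ramification_field ::
    "('a::alg_closed_field \<Rightarrow> 'g::linordered_ab_group_add extended) \<Rightarrow> 'a set \<Rightarrow> 'a set"
  where "ramification_field v F =
    {x \<in> sep_cl F. \<forall>\<sigma>\<in>Gal F. (\<forall>c\<in>sep_cl F - {0}. v c < v (\<sigma> c - c)) \<longrightarrow> \<sigma> x = x}"

definition implicit_constant_field ::
    "('a::alg_closed_field \<Rightarrow> 'g::linordered_ab_group_add extended) \<Rightarrow> 'a set \<Rightarrow> 'a \<Rightarrow> 'a set"
  where "implicit_constant_field v K x = alg_cl K \<inter> henselization v (adjoin K x)"

end

theory Submission
  imports Defs
begin

text \<open>
  Both inclusions are statements about automorphisms of \<open>\<Omega>\<close> that preserve the valuation, and both rest
  on extending a suitable isomorphism between subfields of \<open>\<Omega>\<close> to algebraic closures. Write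
  \<open>C = alg_cl K\<close>. Since \<open>\<gamma>\<close> is the largest value of an element \<open>x - c\<close> with \<open>c \<in> C\<close>, one has
  \<open>v (x - c) = min \<gamma> (v (a - c))\<close> for all \<open>c \<in> C\<close>.

  \<^emph>\<open>Upper inclusion.\<close> Let \<open>\<sigma>\<close> be an automorphism of \<open>C\<close> over \<open>K(a)\<close> that preserves \<open>v\<close>. It fixes \<open>a\<close>, so
  the formula for \<open>v (x - c)\<close> shows that extending \<open>\<sigma>\<close> to \<open>C(x)\<close> by \<open>x \<mapsto> x\<close> preserves \<open>v\<close>: every
  polynomial over \<open>C\<close> is a product of linear factors. By \<open>value_preserving_extension\<close> this map extends to an
  automorphism of \<open>\<Omega>\<close> over \<open>K(x)\<close> that preserves \<open>v\<close>. It fixes every element of the implicit constant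
  field, hence so does \<open>\<sigma>\<close>.

  \<^emph>\<open>Lower inclusion.\<close> Let \<open>\<sigma>\<close> be an automorphism of \<open>\<Omega>\<close> over \<open>K(x)\<close> that preserves \<open>v\<close>. Then
  \<open>v (\<sigma> a - a) \<ge> \<gamma>\<close>, because \<open>x - a\<close> and \<open>x - \<sigma> a\<close> both have value \<open>\<gamma>\<close>. An element of \<open>K(a)\<close> is \<open>f(a)\<close>
  for a polynomial \<open>f\<close> over \<open>K\<close> of degree less than \<open>[K(a):K]\<close>; by minimality of the pair its roots \<open>c\<close>
  satisfy \<open>v (a - c) < \<gamma>\<close>, so \<open>\<sigma>\<close> changes each factor \<open>a - c\<close>, and then \<open>f(a)\<close> itself, only by a
  quantity of larger value. In other words, \<open>\<sigma>\<close> acts on \<open>K(a)\<close> like an element of the ramification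
  group. By \<open>close_extension\<close> the restriction of \<open>\<sigma>\<close> to \<open>K(a)\<close> extends to an actual element of the
  ramification group of \<open>K\<close>; so \<open>\<sigma>\<close> fixes \<open>L = K(a) \<inter> K\<^sup>r\<close> pointwise. It therefore restricts to an
  automorphism of \<open>alg_cl L\<close> over \<open>L\<close> that preserves \<open>v\<close>, and fixes the henselization of \<open>L\<close>.

  The first extension theorem is the conjugacy of extensions of a valuation. By Zorn's lemma it
  is enough to adjoin one algebraic element \<open>y\<close>. If each of the finitely many conjugates of \<open>y\<close>
  were a bad choice for its image, multiplying the witnesses with suitable exponents would give a single
  element whose value differs from the values of all its conjugates (\<open>avoid_kernels\<close>); but the values
  of the coefficients of a polynomial determine the values of its roots (\<open>root_of_same_value\<close>). For
  the second theorem, call \<open>z\<close> and \<open>w\<close> close if they have the same leading term, that is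
  \<open>v (w - z) > v z\<close> or \<open>z = w\<close>. An isomorphism that moves every element to a close one can be extended
  in the same way until each element \<open>z\<close> of the algebraic closure is close to an element of the domain
  (\<open>close_step\<close>: adjoin an element close to \<open>z\<close> of least possible degree). From there any extension
  preserving the values works.

  In addition one needs that the elements that are separable over a field form a field and that
  separability is transitive. Both follow from \<open>mem_base_of_power\<close>: a purely inseparable element of
  a separable simple extension lies in the base field.
\<close>

hide_const (open) Polynomials.degree Polynomials.lead_coeff up_ring.coeff up_ring.monom module.smult

section \<open>Subfields of the ambient field\<close>

lemma Omega_simps [simp]:
  "carrier \<Omega> = UNIV" "(\<otimes>\<^bsub>\<Omega>\<^esub>) = (*)" "(\<oplus>\<^bsub>\<Omega>\<^esub>) = (+)" "\<one>\<^bsub>\<Omega>\<^esub> = 1" "\<zero>\<^bsub>\<Omega>\<^esub> = 0"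
  by (simp_all add: ring_of_type_algebra_def)

lemmas Omega_field = field_from_type_algebra

interpretation Omega: domain "\<Omega> :: 'a::field ring"
  by (rule field.axioms(1)[OF Omega_field])

lemma Omega_a_inv [simp]: "\<ominus>\<^bsub>\<Omega>\<^esub> (z :: 'a::field) = - z"
  using Omega.minus_equality[of "- z" z] by simp

lemma Omega_m_inv [simp]: "z \<noteq> 0 \<Longrightarrow> inv\<^bsub>\<Omega>\<^esub> (z :: 'a::field) = inverse z"
  using Omega.inv_unique'[of z "inverse z"] by simp

lemma Omega_pow [simp]: "z [^]\<^bsub>\<Omega>\<^esub> (n::nat) = (z :: 'a::field) ^ n"
  by (induction n) (simp_all add: mult.commute)

lemma subfield_OmegaI:
  fixes F :: "'a::field set"
  assumes "1 \<in> F" "\<And>z w. z \<in> F \<Longrightarrow> w \<in> F \<Longrightarrow> z + w \<in> F" "\<And>z w. z \<in> F \<Longrightarrow> w \<in> F \<Longrightarrow> z * w \<in> F"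
    "\<And>z. z \<in> F \<Longrightarrow> - z \<in> F" "\<And>z. z \<in> F \<Longrightarrow> z \<noteq> 0 \<Longrightarrow> inverse z \<in> F"
  shows "subfield F \<Omega>"
  by (rule field.subfieldI'[OF Omega_field Omega.subringI]) (use assms in auto)

context
  fixes F :: "'a::field set"
  assumes F: "subfield F \<Omega>"
begin

lemma sf_0: "0 \<in> F" and sf_1: "1 \<in> F"
  using subringE(2,3)[OF subfieldE(1)[OF F]] by simp_all

lemma sf_add: "z \<in> F \<Longrightarrow> w \<in> F \<Longrightarrow> z + w \<in> F"
  using subringE(7)[OF subfieldE(1)[OF F]] by simp

lemma sf_mult: "z \<in> F \<Longrightarrow> w \<in> F \<Longrightarrow> z * w \<in> F"
  using subringE(6)[OF subfieldE(1)[OF F]] by simp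

lemma sf_uminus: "z \<in> F \<Longrightarrow> - z \<in> F"
  using subringE(5)[OF subfieldE(1)[OF F]] by simp

lemma sf_diff: "z \<in> F \<Longrightarrow> w \<in> F \<Longrightarrow> z - w \<in> F"
  using sf_add[of z "- w"] sf_uminus by simp

lemma sf_inverse: "z \<in> F \<Longrightarrow> inverse z \<in> F"
  using Omega.subfield_m_inv(1)[OF F, of z] sf_0 by (cases "z = 0") auto

lemma sf_divide: "z \<in> F \<Longrightarrow> w \<in> F \<Longrightarrow> z / w \<in> F"
  unfolding divide_inverse by (intro sf_mult sf_inverse)

lemma sf_power: "z \<in> F \<Longrightarrow> z ^ n \<in> F"
  by (induction n) (auto intro: sf_1 sf_mult)

lemma sf_sum: "(\<And>i. i \<in> I \<Longrightarrow> f i \<in> F) \<Longrightarrow> sum f I \<in> F"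
  by (induction I rule: infinite_finite_induct) (auto intro: sf_0 sf_add)

lemma sf_of_nat: "of_nat n \<in> F"
  by (induction n) (auto intro: sf_0 sf_1 sf_add)

end

lemmas sf_intros = sf_0 sf_1 sf_add sf_mult sf_uminus sf_diff sf_inverse sf_divide sf_power sf_sum sf_of_nat

lemma subfield_adjoin: "subfield (adjoin F z) \<Omega>"
  unfolding adjoin_def by (rule field.generate_field_is_subfield[OF Omega_field]) simp

lemma adjoin_incl: "F \<subseteq> adjoin F z"
  unfolding adjoin_def by (auto intro: generate_field.incl)

lemma adjoin_mem: "z \<in> adjoin F z"
  unfolding adjoin_def by (auto intro: generate_field.incl)

lemma adjoin_least: "subfield E \<Omega> \<Longrightarrow> F \<subseteq> E \<Longrightarrow> z \<in> E \<Longrightarrow> adjoin F z \<subseteq> E"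
  unfolding adjoin_def by (rule field.generate_field_min_subfield1[OF Omega_field]) auto

lemma subfield_Int: "subfield E \<Omega> \<Longrightarrow> subfield F \<Omega> \<Longrightarrow> subfield (E \<inter> F) \<Omega>"
  by (rule subfield_OmegaI) (auto intro: sf_intros)

section \<open>Polynomials over a subfield\<close>

definition polys :: "'a::field set \<Rightarrow> 'a poly set"
  where "polys F = {p. \<forall>i. coeff p i \<in> F}"

lemma polysI: "(\<And>i. coeff p i \<in> F) \<Longrightarrow> p \<in> polys F"
  by (simp add: polys_def)

lemma polysD: "p \<in> polys F \<Longrightarrow> coeff p i \<in> F"
  by (simp add: polys_def)

lemma polys_mono: "F \<subseteq> E \<Longrightarrow> polys F \<subseteq> polys E"
  by (auto simp: polys_def)

context
  fixes F :: "'a::field set"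
  assumes F: "subfield F \<Omega>"
begin

lemma polys_0: "0 \<in> polys F" and polys_1: "1 \<in> polys F"
  by (auto simp: polys_def sf_0[OF F] sf_1[OF F] coeff_1)

lemma polys_pCons: "c \<in> F \<Longrightarrow> p \<in> polys F \<Longrightarrow> pCons c p \<in> polys F"
  by (auto simp: polys_def coeff_pCons split: nat.splits)

lemma polys_add: "p \<in> polys F \<Longrightarrow> q \<in> polys F \<Longrightarrow> p + q \<in> polys F"
  by (auto simp: polys_def intro: sf_add[OF F])

lemma polys_diff: "p \<in> polys F \<Longrightarrow> q \<in> polys F \<Longrightarrow> p - q \<in> polys F"
  by (auto simp: polys_def intro: sf_diff[OF F])

lemma polys_mult: "p \<in> polys F \<Longrightarrow> q \<in> polys F \<Longrightarrow> p * q \<in> polys F"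
  by (auto simp: polys_def coeff_mult intro: sf_sum[OF F] sf_mult[OF F])

lemma polys_monom: "c \<in> F \<Longrightarrow> monom c n \<in> polys F"
  by (auto simp: polys_def intro: sf_0[OF F])

lemma polys_smult: "c \<in> F \<Longrightarrow> p \<in> polys F \<Longrightarrow> smult c p \<in> polys F"
  by (auto simp: polys_def intro: sf_mult[OF F])

lemma polys_power: "p \<in> polys F \<Longrightarrow> p ^ n \<in> polys F"
  by (induction n) (auto intro: polys_1 polys_mult)

lemma polys_pderiv: "p \<in> polys F \<Longrightarrow> pderiv p \<in> polys F"
  by (auto simp: polys_def coeff_pderiv intro!: sf_mult[OF F] sf_add[OF F] sf_1[OF F] sf_of_nat[OF F])

lemma poly_in_subfield: "p \<in> polys F \<Longrightarrow> z \<in> F \<Longrightarrow> poly p z \<in> F"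
  by (auto simp: poly_altdef polys_def intro!: sf_sum[OF F] sf_mult[OF F] sf_power[OF F])

text \<open>
  Long division by a monic polynomial never divides by a coefficient, so it stays inside the
  polynomials over \<open>F\<close>.
\<close>

lemma polys_monic_division:
  assumes m: "m \<in> polys F" "lead_coeff m = 1"
  shows "p \<in> polys F \<Longrightarrow> \<exists>q\<in>polys F. \<exists>s\<in>polys F. p = m * q + s \<and> (s = 0 \<or> degree s < degree m)"
proof (induction "degree p" arbitrary: p rule: less_induct)
  case less
  let ?n = "degree p" and ?d = "degree m" and ?c = "lead_coeff p"
  show ?case
  proof (cases "p = 0 \<or> ?n < ?d")
    case True
    then show ?thesis
      using less.prems polys_0 by (intro bexI[of _ 0] bexI[of _ p]) auto
  next
    case False
    then have ne: "p \<noteq> 0" and le: "?d \<le> ?n" by auto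
    define t where "t = monom ?c (?n - ?d)"
    have t: "t \<in> polys F" unfolding t_def using less.prems by (intro polys_monom polysD)
    define p' where "p' = p - m * t"
    have p': "p' \<in> polys F" unfolding p'_def by (intro polys_diff polys_mult less.prems m t)
    have m0: "m \<noteq> 0" using m by auto
    have t0: "t \<noteq> 0" using ne by (simp add: t_def)
    have degt: "degree (m * t) = ?n"
      using m0 t0 le ne by (subst degree_mult_eq) (auto simp: t_def degree_monom_eq)
    have coe: "coeff (m * t) ?n = ?c"
      using lead_coeff_mult[of m t] m degt ne by (simp add: t_def degree_monom_eq)
    show ?thesis
    proof (cases "p' = 0")
      case True
      then have "p = m * t + 0" by (simp add: p'_def)
      then show ?thesis using t polys_0 by blast
    next
      case ne': False
      have "coeff p' ?n = 0" by (simp add: p'_def coe)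
      moreover have "degree p' \<le> ?n"
        unfolding p'_def using degt degree_diff_le by (metis order_refl)
      ultimately have "degree p' < ?n"
        using ne' leading_coeff_0_iff[of p'] by (metis le_neq_implies_less)
      from less.hyps[OF this p'] obtain q s where
        "q \<in> polys F" "s \<in> polys F" "p' = m * q + s" "s = 0 \<or> degree s < ?d" by blast
      then have "p = m * (q + t) + s" by (simp add: p'_def algebra_simps)
      then show ?thesis using \<open>q \<in> _\<close> \<open>s \<in> _\<close> \<open>s = 0 \<or> _\<close> t polys_add by blast
    qed
  qed
qed

end

lemma polys_pcompose:
  assumes F: "subfield F \<Omega>" and "p \<in> polys F" "q \<in> polys F"
  shows "pcompose p q \<in> polys F"
  using assms(2)
proof (induction p)
  case (pCons c p)
  have "p \<in> polys F" "c \<in> F"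
    using polysD[OF pCons.prems, of 0] polysD[OF pCons.prems, of "Suc _"] by (auto simp: polys_def)
  then show ?case unfolding pcompose_pCons
    using pCons.IH by (intro polys_add[OF F] polys_mult[OF F] polys_pCons[OF F] polys_0[OF F] assms(3))
qed (simp add: polys_0[OF F])

lemma polys_quotient:
  assumes F: "subfield F \<Omega>" and m: "m \<in> polys F" "lead_coeff m = 1" and p: "m * q \<in> polys F"
  shows "q \<in> polys F"
proof -
  obtain q' s where qs: "q' \<in> polys F" "m * q = m * q' + s" "s = 0 \<or> degree s < degree m"
    using polys_monic_division[OF F m p] by blast
  have m0: "m \<noteq> 0" using m(2) by auto
  have "m * (q - q') = s" using qs(2) by (simp add: algebra_simps)
  then have "q - q' = 0" using qs(3) m0 degree_mult_eq[of m "q - q'"] by fastforce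
  then show ?thesis using qs(1) by simp
qed

text \<open>
  The form in which algebraic closedness is used: a statement about the roots of a polynomial
  can be proved by splitting off one linear factor at a time.
\<close>

lemma poly_linear_induct [consumes 1, case_names const linear]:
  fixes p :: "'a::alg_closed_field poly"
  assumes "p \<noteq> 0"
    and "\<And>c. c \<noteq> 0 \<Longrightarrow> P [:c:]"
    and "\<And>b q. q \<noteq> 0 \<Longrightarrow> P q \<Longrightarrow> P ([:- b, 1:] * q)"
  shows "P p"
  using assms(1)
proof (induction "degree p" arbitrary: p)
  case 0
  then obtain c where "p = [:c:]" by (metis degree_eq_zeroE)
  then show ?case using assms(2) 0 by auto
next
  case (Suc n)
  then obtain b where "poly p b = 0" using alg_closed_imp_poly_has_root[of p] by auto
  then obtain q where q: "p = [:- b, 1:] * q" by (metis dvdE poly_eq_0_iff_dvd)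
  then have "q \<noteq> 0" using Suc.prems by auto
  then have "n = degree q" using Suc.hyps(2) q by (simp add: degree_mult_eq del: mult_pCons_left)
  then show ?case using Suc.hyps(1) \<open>q \<noteq> 0\<close> assms(3) q by blast
qed

lemma polys_of_roots:
  fixes p :: "'a::alg_closed_field poly"
  assumes F: "subfield F \<Omega>" and "p \<noteq> 0"
  shows "lead_coeff p \<in> F \<longrightarrow> (\<forall>b. poly p b = 0 \<longrightarrow> b \<in> F) \<longrightarrow> p \<in> polys F"
  using assms(2)
proof (induction p rule: poly_linear_induct)
  case (const c)
  then show ?case using polys_pCons[OF F _ polys_0[OF F]] by simp
next
  case (linear b q)
  show ?case
  proof (intro impI)
    assume *: "lead_coeff ([:- b, 1:] * q) \<in> F" "\<forall>c. poly ([:- b, 1:] * q) c = 0 \<longrightarrow> c \<in> F"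
    have "lead_coeff ([:- b, 1:] * q) = lead_coeff q"
      by (subst lead_coeff_mult) simp
    then have "q \<in> polys F" using * linear by simp
    moreover have "b \<in> F" using * by simp
    ultimately show "[:- b, 1:] * q \<in> polys F"
      by (intro polys_mult[OF F] polys_pCons[OF F] sf_uminus[OF F] sf_1[OF F] polys_0[OF F])
  qed
qed

section \<open>Algebraic elements and minimal polynomials\<close>

lemma eval_eq_poly: "Omega.eval p z = poly (Poly (rev p)) (z :: 'a::field)"
  by (induction p) (auto simp: Poly_append poly_monom)

lemma alg_cl_iff:
  fixes F :: "'a::field set"
  assumes F: "subfield F \<Omega>"
  shows "z \<in> alg_cl F \<longleftrightarrow> (\<exists>p\<in>polys F. p \<noteq> 0 \<and> poly p z = 0)"
proof
  assume "z \<in> alg_cl F"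
  then have "(Omega.algebraic over F) z" by (simp add: alg_cl_def)
  then obtain p where p: "p \<in> carrier (univ_poly \<Omega> F)" "p \<noteq> []" "Omega.eval p z = 0"
    using Omega.algebraicE[OF subfieldE(1)[OF F], of z] by auto
  have *: "set p \<subseteq> F" "hd p \<noteq> 0"
    using p unfolding univ_poly_carrier[symmetric] polynomial_def by auto
  have "coeff (Poly (rev p)) i \<in> F" for i
    using *(1) sf_0[OF F] by (auto simp: nth_default_def rev_nth subset_iff)
  moreover have "Poly (rev p) \<noteq> 0"
  proof
    assume "Poly (rev p) = 0"
    then have "coeff (Poly (rev p)) (length p - 1) = 0" by simp
    then show False using p(2) *(2) by (simp add: nth_default_def rev_nth hd_conv_nth)
  qed
  ultimately show "\<exists>p\<in>polys F. p \<noteq> 0 \<and> poly p z = 0"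
    using p(3) by (intro bexI[of _ "Poly (rev p)"]) (auto simp: eval_eq_poly polys_def)
next
  assume "\<exists>p\<in>polys F. p \<noteq> 0 \<and> poly p z = 0"
  then obtain p where p: "p \<in> polys F" "p \<noteq> 0" "poly p z = 0" by blast
  define l where "l = rev (coeffs p)"
  have "l \<in> carrier (univ_poly \<Omega> F)"
    unfolding univ_poly_carrier[symmetric] polynomial_def l_def
    using p by (auto simp: coeffs_def polys_def hd_rev last_coeffs_eq_coeff_degree last_map)
  moreover have "l \<noteq> []" using p by (simp add: l_def)
  moreover have "Omega.eval l z = 0" using p(3) by (simp add: eval_eq_poly l_def)
  ultimately show "z \<in> alg_cl F"
    using Omega.algebraicI by (auto simp: alg_cl_def over_def)
qed

context
  fixes F :: "'a::field set" and z
  assumes F: "subfield F \<Omega>" and z: "z \<in> alg_cl F"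
begin

private lemma alg: "(Omega.algebraic over F) z"
  using z by (simp add: alg_cl_def)

private lemmas Irr = Omega.IrrE[OF F _ alg, simplified]

private lemma Irr_ne: "Omega.Irr F z \<noteq> []"
  using Irr(3) Irr(2) Omega.pirreducibleE(1)[OF subfieldE(1)[OF F] Irr(1)] by auto

private lemma Irr_coeff: "coeff (min_poly F z) (length (Omega.Irr F z) - 1) = 1"
  using Irr_ne Irr(3) by (simp add: min_poly_def nth_default_def rev_nth hd_conv_nth)

private lemma Irr_degree: "degree (min_poly F z) = length (Omega.Irr F z) - 1"
proof (rule antisym)
  show "length (Omega.Irr F z) - 1 \<le> degree (min_poly F z)"
    using Irr_coeff by (intro le_degree) auto
  show "degree (min_poly F z) \<le> length (Omega.Irr F z) - 1"
    by (rule degree_le) (auto simp: min_poly_def nth_default_def)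
qed

lemma min_poly_polys: "min_poly F z \<in> polys F"
proof -
  have "set (Omega.Irr F z) \<subseteq> F"
    using Irr(1) Irr_ne unfolding univ_poly_carrier[symmetric] polynomial_def by auto
  then show ?thesis
    using sf_0[OF F] by (auto simp: polys_def min_poly_def nth_default_def rev_nth subset_iff)
qed

lemma min_poly_monic: "lead_coeff (min_poly F z) = 1"
  using Irr_coeff Irr_degree by simp

lemma min_poly_nonzero: "min_poly F z \<noteq> 0"
  using min_poly_monic by auto

lemma min_poly_root: "poly (min_poly F z) z = 0"
  using Irr(4) by (simp add: min_poly_def eval_eq_poly)

lemma degree_min_poly_le:
  assumes "p \<in> polys F" "p \<noteq> 0" "poly p z = 0"
  shows "degree (min_poly F z) \<le> degree p"
proof -
  define l where "l = rev (coeffs p)"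
  have l: "l \<in> carrier (univ_poly \<Omega> F)"
    unfolding univ_poly_carrier[symmetric] polynomial_def l_def
    using assms by (auto simp: coeffs_def polys_def hd_rev last_coeffs_eq_coeff_degree last_map)
  moreover have ne: "l \<noteq> []" using assms by (simp add: l_def)
  moreover have "Omega.eval l z = 0" using assms(3) by (simp add: eval_eq_poly l_def)
  ultimately have "Omega.Irr F z pdivides\<^bsub>\<Omega>\<^esub> l"
    using Omega.Irr_minimal[OF F _ alg] by simp
  then have "length (Omega.Irr F z) - 1 \<le> length l - 1"
    using Omega.pdivides_imp_degree_le[OF subfieldE(1)[OF F] Irr(1) l ne] by simp
  then show ?thesis
    by (simp add: Irr_degree l_def length_coeffs_degree assms(2))
qed

lemma min_poly_dvd:
  assumes "p \<in> polys F" "poly p z = 0"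
  shows "\<exists>q\<in>polys F. p = min_poly F z * q"
proof -
  obtain q s where qs: "q \<in> polys F" "s \<in> polys F" "p = min_poly F z * q + s"
    "s = 0 \<or> degree s < degree (min_poly F z)"
    using polys_monic_division[OF F min_poly_polys min_poly_monic assms(1)] by blast
  have "poly s z = 0" using qs(3) assms(2) min_poly_root by simp
  then have "s = 0" using qs(2,4) degree_min_poly_le[of s] by (meson not_le)
  then show ?thesis using qs by auto
qed

lemma degree_min_poly_pos: "0 < degree (min_poly F z)"
proof (rule ccontr)
  assume "\<not> ?thesis"
  then obtain c where "min_poly F z = [:c:]" by (metis degree_eq_zeroE gr0I)
  then show False using min_poly_monic min_poly_root by (auto split: if_splits)
qed

private lemma simple_extension_eq: "Omega.simple_extension F z = (\<lambda>p. poly p z) ` polys F"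
proof
  show "Omega.simple_extension F z \<subseteq> (\<lambda>p. poly p z) ` polys F"
  proof
    fix w assume "w \<in> Omega.simple_extension F z"
    then show "w \<in> (\<lambda>p. poly p z) ` polys F"
    proof induction
      case zero
      then show ?case using polys_0[OF F] by (auto intro!: image_eqI[of _ _ 0])
    next
      case (lin k1 k2)
      then obtain p where "p \<in> polys F" "k1 = poly p z" by blast
      then show ?case using polys_pCons[OF F lin(2), of p]
        by (intro image_eqI[of _ _ "pCons k2 p"]) auto
    qed
  qed
next
  have "poly p z \<in> Omega.simple_extension F z" if "p \<in> polys F" for p
    using that
  proof (induction p)
    case 0
    then show ?case using Omega.simple_extension.zero[of F z] by simp
  next
    case (pCons c p)
    have "p \<in> polys F" "c \<in> F"
      using polysD[OF pCons.prems, of 0] polysD[OF pCons.prems, of "Suc _"] by (auto simp: polys_def)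
    then show ?case
      using Omega.simple_extension.lin[OF pCons.IH, of c] by (simp add: algebra_simps)
  qed
  then show "(\<lambda>p. poly p z) ` polys F \<subseteq> Omega.simple_extension F z" by blast
qed

private lemma adjoin_eq_simple_extension: "adjoin F z = Omega.simple_extension F z"
proof
  have sub: "subfield (Omega.simple_extension F z) \<Omega>"
    using Omega.simple_extension_is_subfield[OF F, of z] alg by simp
  show "adjoin F z \<subseteq> Omega.simple_extension F z"
    using Omega.simple_extension_incl[of F z] Omega.simple_extension_mem[OF subfieldE(1)[OF F], of z]
    by (intro adjoin_least[OF sub]) auto
  show "Omega.simple_extension F z \<subseteq> adjoin F z"
    unfolding simple_extension_eq
    using poly_in_subfield[OF subfield_adjoin] polys_mono[OF adjoin_incl] adjoin_mem by blast
qed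

lemma ext_degree_adjoin: "ext_degree (adjoin F z) F = degree (min_poly F z)"
  unfolding ext_degree_def adjoin_eq_simple_extension Irr_degree
  using Omega.simple_extension_dim[OF F _ alg] by simp

lemma adjoin_alg: "adjoin F z = (\<lambda>p. poly p z) ` polys F"
  using adjoin_eq_simple_extension simple_extension_eq by simp

lemma adjoin_alg_reduced:
  assumes "w \<in> adjoin F z"
  obtains p where "p \<in> polys F" "p = 0 \<or> degree p < degree (min_poly F z)" "w = poly p z"
proof -
  obtain p where p: "p \<in> polys F" "w = poly p z" using assms adjoin_alg by auto
  obtain q s where qs: "q \<in> polys F" "s \<in> polys F" "p = min_poly F z * q + s"
    "s = 0 \<or> degree s < degree (min_poly F z)"
    using polys_monic_division[OF F min_poly_polys min_poly_monic p(1)] by blast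
  show ?thesis using that[of s] qs p min_poly_root by simp
qed

end

lemma subfield_alg_cl: "subfield F \<Omega> \<Longrightarrow> subfield (alg_cl F) \<Omega>"
  using field.subfield_of_algebraics[OF Omega_field, of F] by (simp add: alg_cl_def)

lemma alg_cl_incl: "subfield F \<Omega> \<Longrightarrow> F \<subseteq> alg_cl F"
  using Omega.algebraic_self[OF subfieldE(1)] by (auto simp: alg_cl_def)

lemma alg_cl_mono: "F \<subseteq> E \<Longrightarrow> alg_cl F \<subseteq> alg_cl E"
  unfolding alg_cl_def using Omega.algebraic_mono by blast

text \<open>
  An element \<open>z\<close> that is algebraic over \<open>alg_cl F\<close> is algebraic over the field generated by the
  coefficients of one polynomial. That field is finite over \<open>F\<close>, hence so is the field obtained by
  adjoining \<open>z\<close> as well.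
\<close>

lemma alg_cl_idem:
  fixes F :: "'a::field set"
  assumes F: "subfield F \<Omega>"
  shows "alg_cl (alg_cl F) = alg_cl F"
proof
  show "alg_cl (alg_cl F) \<subseteq> alg_cl F"
  proof
    fix z assume "z \<in> alg_cl (alg_cl F)"
    then obtain p where p: "p \<in> polys (alg_cl F)" "p \<noteq> 0" "poly p z = 0"
      using alg_cl_iff[OF subfield_alg_cl[OF F]] by blast
    define E where "E = Omega.finite_extension F (coeffs p)"
    have alg: "(Omega.algebraic over F) c" if "c \<in> set (coeffs p)" for c
      using p(1) that by (auto simp: coeffs_def polys_def alg_cl_def split: if_splits)
    have E: "subfield E \<Omega>"
      unfolding E_def by (rule Omega.finite_extension_is_subfield[OF F]) (use alg in auto)
    have fin: "Omega.finite_dimension F E"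
      unfolding E_def by (rule Omega.finite_extension_finite_dimension(1)[OF F]) (use alg in auto)
    have "set (coeffs p) \<subseteq> E"
      unfolding E_def using Omega.finite_extension_mem[OF subfieldE(1)[OF F]] by simp
    then have "coeff p i \<in> E" for i
      using coeff_in_coeffs[OF p(2), of i] sf_0[OF E] by (cases "i \<le> degree p") (auto simp: coeff_eq_0)
    then have "p \<in> polys E" by (rule polysI)
    then have z: "z \<in> alg_cl E" using p alg_cl_iff[OF E] by blast
    define M where "M = Omega.simple_extension E z"
    have algz: "(Omega.algebraic over E) z" using z by (simp add: alg_cl_def)
    have "Omega.finite_dimension E M"
      unfolding M_def using Omega.finite_dimension_simple_extension[OF E] algz by simp
    then have "Omega.finite_dimension F M"
      by (rule Omega.telescopic_base_dim(1)[OF F E fin])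
    moreover have "subring M \<Omega>"
      unfolding M_def by (rule Omega.simple_extension_is_subring[OF subfieldE(1)[OF E]]) simp
    moreover have "z \<in> M"
      unfolding M_def by (rule Omega.simple_extension_mem[OF subfieldE(1)[OF E]]) simp
    ultimately show "z \<in> alg_cl F"
      using Omega.finite_dimension_imp_algebraic[OF F] by (simp add: alg_cl_def)
  qed
qed (rule alg_cl_incl[OF subfield_alg_cl[OF F]])

lemma alg_cl_intermediate:
  assumes "subfield F \<Omega>" "F \<subseteq> E" "E \<subseteq> alg_cl F"
  shows "alg_cl E = alg_cl F"
  using assms alg_cl_mono alg_cl_idem by blast

section \<open>Partial isomorphisms\<close>

text \<open>
  An isomorphism between two subfields of \<open>\<Omega>\<close> is represented by its graph: a set of pairs that is
  closed under the field operations of \<open>\<Omega> \<times> \<Omega>\<close>. Extending an isomorphism is then inclusion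
  of sets, and the union of a chain is again one. The condition on \<open>(0, b)\<close> is what makes the set the graph
  of an injective map.
\<close>

definition partial_iso :: "('a::field \<times> 'a) set \<Rightarrow> bool"
  where "partial_iso r \<longleftrightarrow> (1, 1) \<in> r
    \<and> (\<forall>a b c d. (a, b) \<in> r \<longrightarrow> (c, d) \<in> r \<longrightarrow> (a + c, b + d) \<in> r \<and> (a * c, b * d) \<in> r)
    \<and> (\<forall>a b. (a, b) \<in> r \<longrightarrow> (- a, - b) \<in> r \<and> (inverse a, inverse b) \<in> r)
    \<and> (\<forall>b. (0, b) \<in> r \<longrightarrow> b = 0)"

definition rel_poly :: "('a::field \<times> 'a) set \<Rightarrow> 'a poly \<Rightarrow> 'a poly \<Rightarrow> bool"
  where "rel_poly r p q \<longleftrightarrow> (\<forall>i. (coeff p i, coeff q i) \<in> r)"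

lemma rel_polyD: "rel_poly r p q \<Longrightarrow> (coeff p i, coeff q i) \<in> r"
  by (simp add: rel_poly_def)

lemma rel_poly_mono: "rel_poly r p q \<Longrightarrow> r \<subseteq> s \<Longrightarrow> rel_poly s p q"
  by (auto simp: rel_poly_def)

lemma rel_poly_polys: "rel_poly r p q \<Longrightarrow> p \<in> polys (Domain r)"
  by (auto simp: rel_poly_def polys_def)

lemma rel_poly_exists:
  assumes "p \<in> polys (Domain r)" "(0, 0) \<in> r"
  obtains q where "rel_poly r p q"
proof -
  have "\<forall>i. \<exists>b. (coeff p i, b) \<in> r" using assms by (auto simp: polys_def)
  then obtain f where f: "\<And>i. (coeff p i, f i) \<in> r" by metis
  define q where "q = (\<Sum>i\<le>degree p. monom (f i) i)"
  have "coeff q i = (if i \<le> degree p then f i else 0)" for i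
    by (simp add: q_def coeff_sum)
  then have "rel_poly r p q"
    using f assms(2) by (auto simp: rel_poly_def coeff_eq_0)
  then show ?thesis by (rule that)
qed

context
  fixes r :: "('a::field \<times> 'a) set"
  assumes r: "partial_iso r"
begin

lemma pi_1: "(1, 1) \<in> r" and pi_add: "(a, b) \<in> r \<Longrightarrow> (c, d) \<in> r \<Longrightarrow> (a + c, b + d) \<in> r"
  and pi_mult: "(a, b) \<in> r \<Longrightarrow> (c, d) \<in> r \<Longrightarrow> (a * c, b * d) \<in> r"
  and pi_uminus: "(a, b) \<in> r \<Longrightarrow> (- a, - b) \<in> r"
  and pi_inverse: "(a, b) \<in> r \<Longrightarrow> (inverse a, inverse b) \<in> r"
  and pi_zero_left: "(0, b) \<in> r \<Longrightarrow> b = 0"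
  using r unfolding partial_iso_def by blast+

lemma pi_diff: "(a, b) \<in> r \<Longrightarrow> (c, d) \<in> r \<Longrightarrow> (a - c, b - d) \<in> r"
  using pi_add[of a b "- c" "- d"] pi_uminus by simp

lemma pi_0: "(0, 0) \<in> r"
  using pi_diff[OF pi_1 pi_1] by simp

lemma pi_power: "(a, b) \<in> r \<Longrightarrow> (a ^ n, b ^ n) \<in> r"
  by (induction n) (auto intro: pi_1 pi_mult)

lemma pi_sum: "(\<And>i. i \<in> I \<Longrightarrow> (f i, g i) \<in> r) \<Longrightarrow> (sum f I, sum g I) \<in> r"
  by (induction I rule: infinite_finite_induct) (auto intro: pi_0 pi_add)

lemma pi_single_valued: "(a, b) \<in> r \<Longrightarrow> (a, c) \<in> r \<Longrightarrow> b = c"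
  using pi_diff[of a b a c] pi_zero_left[of "b - c"] by simp

lemma pi_zero_right: "(a, 0) \<in> r \<Longrightarrow> a = 0"
proof (rule ccontr)
  assume a: "(a, 0) \<in> r" "a \<noteq> 0"
  then have "(1, 0) \<in> r" using pi_mult[OF a(1) pi_inverse[OF a(1)]] by simp
  then show False using pi_single_valued pi_1 by fastforce
qed

lemma pi_injective: "(a, c) \<in> r \<Longrightarrow> (b, c) \<in> r \<Longrightarrow> a = b"
  using pi_diff[of a c b c] pi_zero_right[of "a - b"] by simp

lemma subfield_Domain: "subfield (Domain r) \<Omega>"
  by (rule subfield_OmegaI) (auto intro: pi_1 pi_add pi_mult pi_uminus pi_inverse)

lemma rel_poly_unique: "rel_poly r p q \<Longrightarrow> rel_poly r p q' \<Longrightarrow> q = q'"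
  by (rule poly_eqI) (auto simp: rel_poly_def intro: pi_single_valued)

lemma rel_poly_pCons: "(a, b) \<in> r \<Longrightarrow> rel_poly r p q \<Longrightarrow> rel_poly r (pCons a p) (pCons b q)"
  by (auto simp: rel_poly_def coeff_pCons split: nat.splits)

lemma rel_poly_0: "rel_poly r 0 0"
  by (simp add: rel_poly_def pi_0)

lemma rel_poly_1: "rel_poly r 1 1"
  using rel_poly_pCons[OF pi_1 rel_poly_0] by (simp add: one_pCons)

lemma rel_poly_add: "rel_poly r p q \<Longrightarrow> rel_poly r p' q' \<Longrightarrow> rel_poly r (p + p') (q + q')"
  by (auto simp: rel_poly_def intro: pi_add)

lemma rel_poly_diff: "rel_poly r p q \<Longrightarrow> rel_poly r p' q' \<Longrightarrow> rel_poly r (p - p') (q - q')"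
  by (auto simp: rel_poly_def intro: pi_diff)

lemma rel_poly_uminus: "rel_poly r p q \<Longrightarrow> rel_poly r (- p) (- q)"
  by (auto simp: rel_poly_def intro: pi_uminus)

lemma rel_poly_mult: "rel_poly r p q \<Longrightarrow> rel_poly r p' q' \<Longrightarrow> rel_poly r (p * p') (q * q')"
  by (auto simp: rel_poly_def coeff_mult intro!: pi_sum pi_mult)

lemma rel_poly_zero_iff: "rel_poly r p q \<Longrightarrow> coeff p i = 0 \<longleftrightarrow> coeff q i = 0"
  using pi_zero_left pi_zero_right rel_polyD by metis

lemma rel_poly_degree: "rel_poly r p q \<Longrightarrow> degree q = degree p"
  by (simp add: Polynomial.degree_def rel_poly_zero_iff)

lemma rel_poly_monic: "rel_poly r p q \<Longrightarrow> lead_coeff p = 1 \<Longrightarrow> lead_coeff q = 1"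
  using rel_poly_degree rel_polyD pi_single_valued pi_1 by metis

lemma rel_poly_poly: "rel_poly r p q \<Longrightarrow> (a, b) \<in> r \<Longrightarrow> (poly p a, poly q b) \<in> r"
  using rel_poly_degree[of p q] by (auto simp: poly_altdef rel_poly_def intro!: pi_sum pi_mult pi_power)

lemma rel_poly_dvd:
  assumes "rel_poly r m m'" "rel_poly r p p'" "p = m * q" "q \<in> polys (Domain r)"
  obtains q' where "rel_poly r q q'" "p' = m' * q'"
proof -
  obtain q' where q': "rel_poly r q q'" using rel_poly_exists[OF assms(4) pi_0] by blast
  have "rel_poly r p (m' * q')" using rel_poly_mult[OF assms(1) q'] assms(3) by simp
  then show ?thesis using that q' rel_poly_unique assms(2) by blast
qed

end

subsection \<open>Simple extensions\<close>

text \<open>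
  The candidate for an extension of \<open>r\<close> that maps \<open>y\<close> to \<open>y'\<close>. Using fractions of polynomials treats
  algebraic and transcendental \<open>y\<close> alike; if the polynomials over the domain of \<open>r\<close> that vanish at \<open>y\<close>
  correspond to those that vanish at \<open>y'\<close>, this is an isomorphism.
\<close>

definition simple_ext :: "('a::field \<times> 'a) set \<Rightarrow> 'a \<Rightarrow> 'a \<Rightarrow> ('a \<times> 'a) set"
  where "simple_ext r y y' = {(poly f y / poly g y, poly f' y' / poly g' y') | f f' g g'.
    rel_poly r f f' \<and> rel_poly r g g' \<and> poly g y \<noteq> 0}"

context
  fixes r :: "('a::field \<times> 'a) set" and y y'
  assumes r: "partial_iso r"
    and zeros: "\<And>f f'. rel_poly r f f' \<Longrightarrow> poly f y = 0 \<longleftrightarrow> poly f' y' = 0"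
begin

private lemma simple_extI:
  "rel_poly r f f' \<Longrightarrow> rel_poly r g g' \<Longrightarrow> poly g y \<noteq> 0 \<Longrightarrow> a = poly f y / poly g y \<Longrightarrow>
     b = poly f' y' / poly g' y' \<Longrightarrow> (a, b) \<in> simple_ext r y y'"
  unfolding simple_ext_def by blast

lemma simple_ext_poly:
  assumes "rel_poly r f f'"
  shows "(poly f y, poly f' y') \<in> simple_ext r y y'"
  by (rule simple_extI[OF assms rel_poly_1[OF r]]) auto

lemma simple_ext_incl: "r \<subseteq> simple_ext r y y'"
  using simple_ext_poly rel_poly_pCons[OF r _ rel_poly_0[OF r]] by fastforce

lemma simple_ext_mem: "(y, y') \<in> simple_ext r y y'"
  using simple_ext_poly[OF rel_poly_pCons[OF r pi_0[OF r] rel_poly_1[OF r]]] by simp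

lemma partial_iso_simple_ext: "partial_iso (simple_ext r y y')"
  unfolding partial_iso_def
proof (intro conjI allI impI)
  show "(1, 1) \<in> simple_ext r y y'" using simple_ext_incl pi_1[OF r] by blast
next
  fix a b c d assume "(a, b) \<in> simple_ext r y y'" "(c, d) \<in> simple_ext r y y'"
  then obtain f f' g g' h h' k k' where
    *: "rel_poly r f f'" "rel_poly r g g'" "poly g y \<noteq> 0" "a = poly f y / poly g y" "b = poly f' y' / poly g' y'"
    "rel_poly r h h'" "rel_poly r k k'" "poly k y \<noteq> 0" "c = poly h y / poly k y" "d = poly h' y' / poly k' y'"
    unfolding simple_ext_def by blast
  have nz: "poly g' y' \<noteq> 0" "poly k' y' \<noteq> 0" using zeros * by blast+
  show "(a + c, b + d) \<in> simple_ext r y y'"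
    by (rule simple_extI[OF rel_poly_add[OF r rel_poly_mult[OF r *(1,7)] rel_poly_mult[OF r *(6,2)]]
         rel_poly_mult[OF r *(2,7)]]) (use * nz in \<open>simp_all add: add_frac_eq\<close>)
  show "(a * c, b * d) \<in> simple_ext r y y'"
    by (rule simple_extI[OF rel_poly_mult[OF r *(1,6)] rel_poly_mult[OF r *(2,7)]])
       (use * nz in simp_all)
next
  fix a b assume "(a, b) \<in> simple_ext r y y'"
  then obtain f f' g g' where
    *: "rel_poly r f f'" "rel_poly r g g'" "poly g y \<noteq> 0" "a = poly f y / poly g y" "b = poly f' y' / poly g' y'"
    unfolding simple_ext_def by blast
  have nz: "poly g' y' \<noteq> 0" using zeros * by blast
  show "(- a, - b) \<in> simple_ext r y y'"
    by (rule simple_extI[OF rel_poly_uminus[OF r *(1)] *(2)]) (use * in auto)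
  show "(inverse a, inverse b) \<in> simple_ext r y y'"
  proof (cases "poly f y = 0")
    case True
    then have "poly f' y' = 0" using zeros * by blast
    then show ?thesis using True * simple_ext_incl pi_0[OF r] by auto
  next
    case False
    show ?thesis
      by (rule simple_extI[OF *(2,1)]) (simp_all add: *(4,5) False)
  qed
next
  fix b assume "(0, b) \<in> simple_ext r y y'"
  then obtain f f' g g' where
    *: "rel_poly r f f'" "rel_poly r g g'" "poly g y \<noteq> 0" "0 = poly f y / poly g y" "b = poly f' y' / poly g' y'"
    unfolding simple_ext_def by blast
  then have "poly f y = 0" by (metis divide_eq_0_iff)
  then have "poly f' y' = 0" using zeros * by blast
  then show "b = 0" using * by simp
qed

lemma Domain_simple_ext:
  assumes "y \<in> alg_cl (Domain r)"
  shows "Domain (simple_ext r y y') \<subseteq> alg_cl (Domain r)"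
proof
  note D = subfield_Domain[OF r]
  fix a assume "a \<in> Domain (simple_ext r y y')"
  then obtain f f' g g' where *: "rel_poly r f f'" "rel_poly r g g'" "a = poly f y / poly g y"
    unfolding simple_ext_def by blast
  have "poly f y \<in> alg_cl (Domain r)" "poly g y \<in> alg_cl (Domain r)"
    using poly_in_subfield[OF subfield_alg_cl[OF D] _ assms] polys_mono[OF alg_cl_incl[OF D]]
      rel_poly_polys *(1,2) by blast+
  then show "a \<in> alg_cl (Domain r)" using * sf_divide[OF subfield_alg_cl[OF D]] by blast
qed

end

text \<open>
  A polynomial that vanishes at \<open>y\<close> is a multiple of the minimal polynomial, so its image vanishes at
  every root \<open>y'\<close> of \<open>m'\<close>. Conversely, if \<open>f\<close> does not vanish at \<open>y\<close>, then \<open>f(y)\<close> has an inverse \<open>s(y)\<close>,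
  and the image of \<open>s f - 1\<close> vanishes at \<open>y'\<close>.
\<close>

lemma conjugate_zeros:
  assumes r: "partial_iso r" and y: "y \<in> alg_cl (Domain r)"
    and m: "rel_poly r (min_poly (Domain r) y) m'" "poly m' y' = 0"
    and f: "rel_poly r f f'"
  shows "poly f y = 0 \<longleftrightarrow> poly f' y' = 0"
proof -
  note D = subfield_Domain[OF r]
  have imp: "poly h' y' = 0" if h: "rel_poly r h h'" "poly h y = 0" for h h'
  proof -
    obtain q where "q \<in> polys (Domain r)" "h = min_poly (Domain r) y * q"
      using min_poly_dvd[OF D y rel_poly_polys[OF h(1)] h(2)] by blast
    then obtain q' where "h' = m' * q'" using rel_poly_dvd[OF r m(1) h(1)] by blast
    then show ?thesis using m(2) by simp
  qed
  show ?thesis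
  proof
    assume "poly f' y' = 0"
    show "poly f y = 0"
    proof (rule ccontr)
      assume ne: "poly f y \<noteq> 0"
      have "poly f y \<in> adjoin (Domain r) y"
        using adjoin_alg[OF D y] rel_poly_polys[OF f] by blast
      then have "inverse (poly f y) \<in> adjoin (Domain r) y"
        by (rule sf_inverse[OF subfield_adjoin])
      then obtain s where s: "s \<in> polys (Domain r)" "inverse (poly f y) = poly s y"
        using adjoin_alg[OF D y] by auto
      obtain s' where s': "rel_poly r s s'" using rel_poly_exists[OF s(1) pi_0[OF r]] by blast
      have "poly (s * f - 1) y = 0" using s(2) ne by (simp flip: s(2))
      then have "poly (s' * f' - 1) y' = 0"
        by (rule imp[rotated]) (intro rel_poly_diff[OF r] rel_poly_mult[OF r] s' f rel_poly_1[OF r])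
      then show False using \<open>poly f' y' = 0\<close> by simp
    qed
  qed (use imp f in blast)
qed

lemma adjoin_conjugate:
  fixes r :: "('a::field \<times> 'a) set"
  assumes r: "partial_iso r" and y: "y \<in> alg_cl (Domain r)"
    and m: "rel_poly r (min_poly (Domain r) y) m'" "poly m' y' = 0"
  obtains s where "partial_iso s" "r \<subseteq> s" "(y, y') \<in> s" "s = simple_ext r y y'" "Domain s \<subseteq> alg_cl (Domain r)"
  using partial_iso_simple_ext simple_ext_incl simple_ext_mem Domain_simple_ext
    conjugate_zeros[OF assms] r y that by metis

text \<open>
  Zorn's lemma for isomorphisms that satisfy an elementwise condition \<open>P\<close>; such a condition passes to unions
  of chains. The two cases of interest are that \<open>P a b\<close> says that \<open>a\<close> and \<open>b\<close> have the same value, or the same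
  leading term.
\<close>

lemma partial_iso_maximal:
  assumes r0: "partial_iso r0" "\<And>a b. (a, b) \<in> r0 \<Longrightarrow> P a b"
  obtains r where "r0 \<subseteq> r" "partial_iso r" "Domain r \<subseteq> alg_cl (Domain r0)" "\<And>a b. (a, b) \<in> r \<Longrightarrow> P a b"
    "\<And>s. r \<subseteq> s \<Longrightarrow> partial_iso s \<Longrightarrow> Domain s \<subseteq> alg_cl (Domain r0) \<Longrightarrow> (\<And>a b. (a, b) \<in> s \<Longrightarrow> P a b) \<Longrightarrow> s = r"
proof -
  define A where "A = {r. r0 \<subseteq> r \<and> partial_iso r \<and> Domain r \<subseteq> alg_cl (Domain r0) \<and> (\<forall>a b. (a, b) \<in> r \<longrightarrow> P a b)}"
  have "r0 \<in> A" unfolding A_def using r0 alg_cl_incl[OF subfield_Domain[OF r0(1)]] by blast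
  have "\<exists>M\<in>A. \<forall>s\<in>A. M \<subseteq> s \<longrightarrow> s = M"
  proof (rule subset_Zorn_nonempty)
    show "A \<noteq> {}" using \<open>r0 \<in> A\<close> by blast
    fix C assume C: "C \<noteq> {}" "subset.chain A C"
    then have CA: "C \<subseteq> A" by (simp add: subset.chain_def)
    obtain c0 where c0: "c0 \<in> C" using C by blast
    have two: "\<exists>c\<in>C. (a, b) \<in> c \<and> (a', b') \<in> c" if ab: "(a, b) \<in> \<Union>C" "(a', b') \<in> \<Union>C" for a b a' b'
    proof -
      obtain c c' where c: "c \<in> C" "(a, b) \<in> c" "c' \<in> C" "(a', b') \<in> c'" using ab by blast
      then have "c \<subseteq> c' \<or> c' \<subseteq> c" using C(2) by (simp add: subset_chain_def)
      then show ?thesis using c by blast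
    qed
    have iso: "partial_iso (\<Union>C)"
      unfolding partial_iso_def
    proof (intro conjI allI impI)
      have "partial_iso c0" using c0 CA unfolding A_def by blast
      then show "(1, 1) \<in> \<Union>C" using c0 pi_1 by blast
      fix a b c d assume "(a, b) \<in> \<Union>C" "(c, d) \<in> \<Union>C"
      from two[OF this] obtain s where s: "s \<in> C" "(a, b) \<in> s" "(c, d) \<in> s" by blast
      then have "partial_iso s" using CA unfolding A_def by blast
      then show "(a + c, b + d) \<in> \<Union>C" "(a * c, b * d) \<in> \<Union>C"
        using pi_add pi_mult s by blast+
    next
      fix a b assume "(a, b) \<in> \<Union>C"
      then obtain s where s: "s \<in> C" "(a, b) \<in> s" by blast
      then have "partial_iso s" using CA unfolding A_def by blast
      then show "(- a, - b) \<in> \<Union>C" "(inverse a, inverse b) \<in> \<Union>C"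
        using pi_uminus pi_inverse s by blast+
    next
      fix b assume "(0, b) \<in> \<Union>C"
      then obtain s where s: "s \<in> C" "(0, b) \<in> s" by blast
      then have "partial_iso s" using CA unfolding A_def by blast
      then show "b = 0" using pi_zero_left s by blast
    qed
    have in_A: "r0 \<subseteq> s" "Domain s \<subseteq> alg_cl (Domain r0)" "\<And>a b. (a, b) \<in> s \<Longrightarrow> P a b" if "s \<in> C" for s
      using subsetD[OF CA that] unfolding A_def by simp_all
    show "\<Union>C \<in> A" unfolding A_def mem_Collect_eq
    proof (intro conjI allI impI)
      show "r0 \<subseteq> \<Union>C" using in_A(1)[OF c0] c0 by (meson Sup_upper2)
      show "Domain (\<Union>C) \<subseteq> alg_cl (Domain r0)"
        unfolding Domain_Union using in_A(2) by (rule UN_least)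
      show "P a b" if "(a, b) \<in> \<Union>C" for a b
        using that in_A(3)[of _ a b] unfolding Union_iff by (elim bexE)
    qed (rule iso)
  qed
  then obtain M where M: "M \<in> A" and max: "\<And>s. s \<in> A \<Longrightarrow> M \<subseteq> s \<Longrightarrow> s = M" by blast
  show ?thesis
  proof (rule that[of M])
    show "r0 \<subseteq> M" "partial_iso M" "Domain M \<subseteq> alg_cl (Domain r0)" "\<And>a b. (a, b) \<in> M \<Longrightarrow> P a b"
      using M unfolding A_def by simp_all
    then show "s = M" if "M \<subseteq> s" "partial_iso s" "Domain s \<subseteq> alg_cl (Domain r0)" "\<And>a b. (a, b) \<in> s \<Longrightarrow> P a b" for s
      using that by (intro max) (simp_all add: A_def)
  qed
qed

subsection \<open>Automorphisms of algebraic closures\<close>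

context
  fixes F :: "'a::field set" and \<sigma>
  assumes F: "subfield F \<Omega>" and \<sigma>: "\<sigma> \<in> Gal F"
begin

lemma Gal_fixes: "z \<in> F \<Longrightarrow> \<sigma> z = z"
  using \<sigma> by (simp add: Gal_def)

lemma Gal_bij: "bij_betw \<sigma> (alg_cl F) (alg_cl F)"
  using \<sigma> by (simp add: Gal_def ring_iso_def)

lemma Gal_closed: "z \<in> alg_cl F \<Longrightarrow> \<sigma> z \<in> alg_cl F"
  using Gal_bij bij_betwE by blast

lemma Gal_add: "z \<in> alg_cl F \<Longrightarrow> w \<in> alg_cl F \<Longrightarrow> \<sigma> (z + w) = \<sigma> z + \<sigma> w"
  and Gal_mult: "z \<in> alg_cl F \<Longrightarrow> w \<in> alg_cl F \<Longrightarrow> \<sigma> (z * w) = \<sigma> z * \<sigma> w"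
  and Gal_1: "\<sigma> 1 = 1"
  using \<sigma> by (simp_all add: Gal_def ring_iso_def ring_hom_def)

lemma Gal_graph: "E \<subseteq> alg_cl F \<Longrightarrow> subfield E \<Omega> \<Longrightarrow> partial_iso {(z, \<sigma> z) | z. z \<in> E}"
proof -
  assume E: "E \<subseteq> alg_cl F" "subfield E \<Omega>"
  have zero: "\<sigma> 0 = 0" using Gal_fixes[OF sf_0[OF F]] .
  have um: "\<sigma> (- z) = - \<sigma> z" if "z \<in> E" for z
  proof -
    have "\<sigma> z + \<sigma> (- z) = \<sigma> (z + (- z))"
      using Gal_add[of z "- z"] that E sf_uminus[OF E(2)] by (metis subsetD)
    then show ?thesis using zero by (simp add: add_eq_0_iff)
  qed
  have inv: "\<sigma> (inverse z) = inverse (\<sigma> z)" if "z \<in> E" for z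
  proof (cases "z = 0")
    case False
    have "\<sigma> z * \<sigma> (inverse z) = \<sigma> (z * inverse z)"
      using Gal_mult[of z "inverse z"] that E sf_inverse[OF E(2)] by (metis subsetD)
    then show ?thesis using False Gal_1 by (simp add: inverse_unique)
  qed (simp add: zero)
  have "\<sigma> (z + w) = \<sigma> z + \<sigma> w" "\<sigma> (z * w) = \<sigma> z * \<sigma> w" if "z \<in> E" "w \<in> E" for z w
    using that E(1) Gal_add Gal_mult by blast+
  then show ?thesis
    unfolding partial_iso_def
    using zero Gal_1 um inv sf_intros[OF E(2)] by auto
qed

end

lemma Gal_graph_alg_cl:
  assumes "subfield F \<Omega>" "\<sigma> \<in> Gal F"
  shows "partial_iso {(z, \<sigma> z) | z. z \<in> alg_cl F}"
  using Gal_graph[OF assms order_refl subfield_alg_cl[OF assms(1)]] .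

text \<open>
  An embedding of \<open>alg_cl F\<close> into \<open>\<Omega>\<close> over \<open>F\<close> is automatically an automorphism of \<open>alg_cl F\<close>: it maps
  the finite set of roots of a polynomial over \<open>F\<close> injectively into itself, hence onto itself.
\<close>

lemma Gal_of_partial_iso:
  fixes F :: "'a::field set"
  assumes F: "subfield F \<Omega>" and r: "partial_iso r" "Id_on F \<subseteq> r" "Domain r = alg_cl F"
  obtains \<sigma> where "\<sigma> \<in> Gal F" "\<And>z w. (z, w) \<in> r \<Longrightarrow> \<sigma> z = w"
proof -
  define \<sigma> where "\<sigma> z = (THE w. (z, w) \<in> r)" for z
  have \<sigma>: "\<sigma> z = w" if "(z, w) \<in> r" for z w
    unfolding \<sigma>_def using that pi_single_valued[OF r(1)] by blast
  have mem: "(z, \<sigma> z) \<in> r" if "z \<in> alg_cl F" for z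
    using that r(3) \<sigma> by (metis Domain.cases)
  have root: "poly p (\<sigma> z) = 0" if "p \<in> polys F" "poly p z = 0" "z \<in> alg_cl F" for p z
  proof -
    have "rel_poly r p p" using that(1) r(2) by (auto simp: rel_poly_def polys_def)
    then have "(poly p z, poly p (\<sigma> z)) \<in> r" by (rule rel_poly_poly[OF r(1) _ mem[OF that(3)]])
    then show ?thesis using that(2) pi_zero_left[OF r(1)] by simp
  qed
  have into: "\<sigma> z \<in> alg_cl F" if "z \<in> alg_cl F" for z
    using that root alg_cl_iff[OF F] by metis
  have inj: "inj_on \<sigma> (alg_cl F)"
    by (rule inj_onI) (metis mem pi_injective[OF r(1)])
  have surj: "w \<in> \<sigma> ` alg_cl F" if w: "w \<in> alg_cl F" for w
  proof -
    obtain p where p: "p \<in> polys F" "p \<noteq> 0" "poly p w = 0" using w alg_cl_iff[OF F] by blast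
    define S where "S = {z. poly p z = 0}"
    have "finite S" unfolding S_def by (rule poly_roots_finite[OF p(2)])
    moreover have "S \<subseteq> alg_cl F" using p(1,2) alg_cl_iff[OF F] S_def by blast
    moreover have "\<sigma> ` S \<subseteq> S" using root[OF p(1)] \<open>S \<subseteq> _\<close> unfolding S_def by blast
    ultimately have "\<sigma> ` S = S" using endo_inj_surj inj inj_on_subset by metis
    then show ?thesis using p(3) \<open>S \<subseteq> _\<close> unfolding S_def by blast
  qed
  have "\<sigma> \<in> Gal F"
    unfolding Gal_def ring_iso_def ring_hom_def bij_betw_def
    using into inj surj \<sigma> mem pi_add[OF r(1)] pi_mult[OF r(1)] pi_1[OF r(1)] r(2)
    by (auto intro!: \<sigma>)
  then show ?thesis using that \<sigma> by blast
qed

subsection \<open>Algebraic elements of a rational function field\<close>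

lemma partial_iso_Id_on:
  assumes F: "subfield F \<Omega>"
  shows "partial_iso (Id_on F)"
  unfolding partial_iso_def using sf_intros[OF F] by auto

text \<open>
  If \<open>P(x) / Q(x)\<close> equals a constant \<open>c\<close> that is algebraic over \<open>K\<close>, then \<open>x\<close> is a root of \<open>P - c Q\<close>. As
  \<open>x\<close> is transcendental over \<open>alg_cl K\<close>, this polynomial vanishes, and \<open>c\<close> is a quotient of two
  coefficients.
\<close>

lemma alg_cl_Int_adjoin:
  fixes K :: "'a::field set"
  assumes K: "subfield K \<Omega>" and x: "x \<notin> alg_cl K" and c: "c \<in> alg_cl K" "c \<in> adjoin K x"
  shows "c \<in> K"
proof -
  note C = subfield_alg_cl[OF K] and r = partial_iso_Id_on[OF K]
  have rel: "f' = f" if "rel_poly (Id_on K) f f'" for f f'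
    using that by (intro poly_eqI) (auto simp: rel_poly_def)
  then have z: "poly f x = 0 \<longleftrightarrow> poly f' x = 0" if "rel_poly (Id_on K) f f'" for f f'
    using that by blast
  have "adjoin K x \<subseteq> Domain (simple_ext (Id_on K) x x)"
    using simple_ext_incl[OF r z] simple_ext_mem[OF r z]
    by (intro adjoin_least subfield_Domain partial_iso_simple_ext[OF r z]) auto
  then obtain P Q P' Q' where PQ: "rel_poly (Id_on K) P P'" "rel_poly (Id_on K) Q Q'" "poly Q x \<noteq> 0" "c = poly P x / poly Q x"
    using c(2) unfolding simple_ext_def by blast
  have P: "P \<in> polys K" "Q \<in> polys K" using rel_poly_polys PQ(1,2) by force+
  define H where "H = P - smult c Q"
  have "H \<in> polys (alg_cl K)"
    unfolding H_def using P polys_mono[OF alg_cl_incl[OF K]] c(1)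
    by (intro polys_diff[OF C] polys_smult[OF C]) auto
  moreover have "poly H x = 0" using PQ(3,4) by (simp add: H_def)
  ultimately have "H = 0" using x alg_cl_iff[OF C] alg_cl_idem[OF K] by blast
  then have "coeff P i = c * coeff Q i" for i by (simp add: H_def)
  moreover have "Q \<noteq> 0" using PQ(3) by auto
  then obtain i where "coeff Q i \<noteq> 0" by (metis leading_coeff_0_iff)
  ultimately have "c = coeff P i / coeff Q i" by simp
  then show ?thesis using P sf_divide[OF K] polysD by blast
qed

section \<open>Separable elements\<close>

lemma rsquarefree_factor:
  fixes p q :: "'a::idom poly"
  assumes "rsquarefree (p * q)"
  shows "rsquarefree p"
  unfolding rsquarefree_def
proof (intro conjI allI)
  have nz: "p * q \<noteq> 0" using assms by (simp add: rsquarefree_def)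
  then show "p \<noteq> 0" by auto
  fix c
  have "order c p + order c q = 0 \<or> order c p + order c q = 1"
    using assms order_mult[OF nz, of c] unfolding rsquarefree_def by metis
  then show "order c p = 0 \<or> order c p = 1" by auto
qed

lemma rsquarefree_dvd_of_roots:
  fixes p :: "'a::alg_closed_field poly"
  assumes "rsquarefree p"
  shows "(\<And>c. poly p c = 0 \<Longrightarrow> poly h c = 0) \<Longrightarrow> p dvd h"
proof -
  have "p \<noteq> 0" using assms by (simp add: rsquarefree_def)
  then have "rsquarefree p \<longrightarrow> (\<forall>c. poly p c = 0 \<longrightarrow> poly h c = 0) \<longrightarrow> p dvd h"
  proof (induction p rule: poly_linear_induct)
    case (const c)
    then show ?case by (simp add: const_poly_dvd_iff dvd_field_iff)
  next
    case (linear b q)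
    show ?case
    proof (intro impI)
      assume sq: "rsquarefree ([:- b, 1:] * q)" and roots: "\<forall>c. poly ([:- b, 1:] * q) c = 0 \<longrightarrow> poly h c = 0"
      have "rsquarefree q" using rsquarefree_factor[of q "[:- b, 1:]"] sq by (simp add: mult.commute)
      then have "q dvd h" using linear roots by simp
      then obtain k where k: "h = q * k" by blast
      have nz: "[:- b, 1:] * q \<noteq> 0" using sq by (simp add: rsquarefree_def)
      have "order b [:- b, 1:] = 1"
        using order_power_n_n[of b 1] by simp
      then have "order b ([:- b, 1:] * q) = Suc (order b q)" using order_mult[OF nz, of b] by simp
      then have "order b q = 0" using sq unfolding rsquarefree_def by (metis One_nat_def Suc_inject nat.distinct(1))
      then have "poly q b \<noteq> 0" using linear(1) by (simp add: order_root)
      moreover have "poly h b = 0" using roots by simp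
      ultimately have "poly k b = 0" using k by simp
      then obtain k' where "k = [:- b, 1:] * k'" by (metis dvdE poly_eq_0_iff_dvd)
      then show "[:- b, 1:] * q dvd h" using k by (metis dvd_triv_left mult.assoc mult.commute)
    qed
  qed
  then show "(\<And>c. poly p c = 0 \<Longrightarrow> poly h c = 0) \<Longrightarrow> p dvd h" using assms by blast
qed

lemma frobenius_diff:
  fixes a b :: "'a::field"
  assumes "q = CHAR('a) ^ n" "0 < q"
  shows "(a - b) ^ q = a ^ q - b ^ q"
proof (cases "n = 0")
  case False
  then have "CHAR('a) > 0" using assms by (cases "CHAR('a) = 0") auto
  then have "prime CHAR('a)" by (rule prime_CHAR_semidom)
  then have "(a - b + b) ^ q = (a - b) ^ q + b ^ q" by (rule freshmans_dream'[OF _ assms(1)])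
  then show ?thesis by (simp add: algebra_simps)
qed (use assms in simp)

lemma sep_cl_alg_cl: "sep_cl F \<subseteq> alg_cl F"
  by (auto simp: sep_cl_def)

lemma sep_cl_of_root:
  fixes F :: "'a::alg_closed_field set"
  assumes F: "subfield F \<Omega>" and p: "p \<in> polys F" "rsquarefree p" "poly p z = 0"
  shows "z \<in> sep_cl F"
proof -
  have "p \<noteq> 0" using p(2) by (simp add: rsquarefree_def)
  then have z: "z \<in> alg_cl F" using alg_cl_iff[OF F] p by blast
  obtain q where "p = min_poly F z * q" using min_poly_dvd[OF F z p(1,3)] by blast
  then show ?thesis using z p(2) rsquarefree_factor by (auto simp: sep_cl_def)
qed

lemma sep_cl_mono:
  fixes F :: "'a::alg_closed_field set"
  assumes "subfield F \<Omega>" "subfield E \<Omega>" "F \<subseteq> E"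
  shows "sep_cl F \<subseteq> sep_cl E"
proof
  fix z assume z: "z \<in> sep_cl F"
  then have za: "z \<in> alg_cl F" using sep_cl_alg_cl by blast
  show "z \<in> sep_cl E"
    using z min_poly_polys[OF assms(1) za] min_poly_root[OF assms(1) za] polys_mono[OF assms(3)]
    by (intro sep_cl_of_root[OF assms(2), of "min_poly F z"]) (auto simp: sep_cl_def)
qed

lemma sep_cl_incl:
  fixes F :: "'a::alg_closed_field set"
  assumes F: "subfield F \<Omega>"
  shows "F \<subseteq> sep_cl F"
proof
  fix z assume z: "z \<in> F"
  have "rsquarefree [:- z, 1:]"
    unfolding rsquarefree_def
  proof (intro conjI allI)
    fix c
    have "order c [:- z, 1:] \<le> 1" using order_degree[of "[:- z, 1:]" c] by simp
    then show "order c [:- z, 1:] = 0 \<or> order c [:- z, 1:] = 1" by auto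
  qed simp
  moreover have "[:- z, 1:] \<in> polys F"
    using z by (intro polys_pCons[OF F] polys_0[OF F] sf_uminus[OF F] sf_1[OF F])
  ultimately show "z \<in> sep_cl F" using sep_cl_of_root[OF F, of "[:- z, 1:]" z] by simp
qed

text \<open>
  A multiple root of the minimal polynomial is a common root of it and its derivative. Every root of an
  irreducible polynomial has this polynomial as minimal polynomial, so the derivative, having smaller degree,
  must be zero.
\<close>

lemma inseparable_pderiv:
  fixes F :: "'a::alg_closed_field set"
  assumes F: "subfield F \<Omega>" and z: "z \<in> alg_cl F" "z \<notin> sep_cl F"
  shows "pderiv (min_poly F z) = 0"
proof (rule ccontr)
  define p where "p = min_poly F z"
  assume "pderiv (min_poly F z) \<noteq> 0"
  then have d0: "pderiv p \<noteq> 0" by (simp add: p_def)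
  have p: "p \<in> polys F" "p \<noteq> 0" "poly p z = 0"
    unfolding p_def by (rule min_poly_polys[OF F z(1)] min_poly_nonzero[OF F z(1)] min_poly_root[OF F z(1)])+
  have "\<not> rsquarefree p" using z by (simp add: sep_cl_def p_def)
  then obtain c where c: "order c p \<noteq> 0" "order c p \<noteq> 1" using p(2) unfolding rsquarefree_def by blast
  then have "[:- c, 1:] ^ 2 dvd p" by (simp add: order_divides)
  then obtain s where s: "p = [:- c, 1:] * ([:- c, 1:] * s)"
    by (auto simp: power2_eq_square mult.assoc simp del: mult_pCons_left mult_pCons_right)
  have "poly (pderiv p) c = 0" unfolding s pderiv_mult by simp
  moreover have pc: "poly p c = 0" unfolding s by simp
  then have ca: "c \<in> alg_cl F" using p alg_cl_iff[OF F] by blast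
  ultimately have "degree (min_poly F c) \<le> degree (pderiv p)"
    using degree_min_poly_le[OF F ca polys_pderiv[OF F p(1)] d0] by blast
  moreover have "degree (pderiv p) < degree p"
  proof -
    have "degree (pderiv p) \<le> degree p - 1"
      by (intro degree_le) (auto simp: coeff_pderiv intro!: coeff_eq_0)
    then show ?thesis using degree_min_poly_pos[OF F z(1)] by (simp add: p_def)
  qed
  moreover have "degree p \<le> degree (min_poly F c)"
  proof -
    obtain q where q: "q \<in> polys F" "p = min_poly F c * q" using min_poly_dvd[OF F ca p(1) pc] by blast
    have nz: "q \<noteq> 0" using q(2) p(2) by auto
    have "poly q z \<noteq> 0"
    proof
      assume "poly q z = 0"
      then have "degree p \<le> degree q"
        unfolding p_def by (rule degree_min_poly_le[OF F z(1) q(1) nz])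
      then show False
        using q(2) nz min_poly_nonzero[OF F ca] degree_min_poly_pos[OF F ca] by (simp add: degree_mult_eq)
    qed
    then have "poly (min_poly F c) z = 0" using p(3) q(2) by simp
    then show ?thesis
      unfolding p_def by (rule degree_min_poly_le[OF F z(1) min_poly_polys[OF F ca] min_poly_nonzero[OF F ca]])
  qed
  ultimately show False by simp
qed

text \<open>
  The minimal polynomial of an inseparable element has derivative zero, so it is \<open>g(T\<^sup>p)\<close> where \<open>p\<close> is
  the characteristic; then \<open>g\<close> vanishes at \<open>z\<^sup>p\<close>.
\<close>

lemma inseparable_power:
  fixes F :: "'a::alg_closed_field set"
  assumes F: "subfield F \<Omega>" and z: "z \<in> alg_cl F" "z \<notin> sep_cl F"
  shows "0 < CHAR('a)" "z ^ CHAR('a) \<in> alg_cl F"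
    "degree (min_poly F (z ^ CHAR('a))) < degree (min_poly F z)"
proof -
  define m where "m = min_poly F z"
  define d where "d = degree m"
  define p where "p = CHAR('a)"
  have m: "m \<in> polys F" "poly m z = 0" "lead_coeff m = 1" "0 < d"
    unfolding m_def d_def by (rule min_poly_polys[OF F z(1)] min_poly_root[OF F z(1)] min_poly_monic[OF F z(1)] degree_min_poly_pos[OF F z(1)])+
  have zero: "coeff m j = 0" if j: "\<not> p dvd j" for j
  proof -
    obtain n where n: "j = Suc n" using j by (cases j) auto
    have "of_nat (Suc n) * coeff m (Suc n) = 0"
      using inseparable_pderiv[OF F z] coeff_pderiv[of m n] by (simp add: m_def)
    moreover have "of_nat (Suc n) \<noteq> (0 :: 'a)"
      using j n of_nat_eq_0_iff_char_dvd unfolding p_def by blast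
    ultimately show ?thesis using n by (metis mult_eq_0_iff)
  qed
  have "p dvd d" using zero[of d] m(3) by (auto simp: d_def)
  then have p0: "0 < p" using m(4) by (auto intro: gr0I)
  then show "0 < CHAR('a)" by (simp add: p_def)
  have p2: "2 \<le> p" using prime_CHAR_semidom prime_ge_2_nat p0 unfolding p_def by blast
  \<comment> \<open>The minimal polynomial \<open>m\<close> is \<open>g(T\<^sup>p)\<close>; terms with \<open>p * i > d\<close> are zero.\<close>
  define g where "g = (\<Sum>i\<le>d. monom (coeff m (p * i)) i)"
  have cg: "coeff g i = coeff m (p * i)" for i
  proof -
    have "coeff m (p * i) = 0" if "\<not> i \<le> d"
    proof (rule coeff_eq_0)
      have "i \<le> p * i" using p0 by (cases p) simp_all
      then show "degree m < p * i" using that unfolding d_def by linarith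
    qed
    then show ?thesis by (simp add: g_def coeff_sum)
  qed
  have g: "g \<in> polys F" using m(1) by (auto simp: polys_def cg)
  obtain e where e: "d = p * e" using \<open>p dvd d\<close> by blast
  have "coeff g e = 1" using m(3) by (simp add: cg e[symmetric] d_def)
  then have g0: "g \<noteq> 0" by auto
  have "degree g \<le> e"
    using p0 e by (intro degree_le) (auto simp: cg d_def intro!: coeff_eq_0)
  moreover have "e < d"
  proof -
    have "2 * e \<le> d" using p2 e by simp
    then show ?thesis using m(4) by linarith
  qed
  ultimately have deg: "degree g < d" by simp
  have "poly g (z ^ p) = (\<Sum>i\<le>e. coeff m (p * i) * z ^ (p * i))"
    unfolding poly_altdef using \<open>degree g \<le> e\<close>
    by (subst sum.mono_neutral_left[of "{..e}" "{..degree g}"])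
       (auto simp: cg power_mult coeff_eq_0 simp flip: cg)
  also have "\<dots> = (\<Sum>j\<in>(*) p ` {..e}. coeff m j * z ^ j)"
    using p0 by (subst sum.reindex) (auto simp: inj_on_def)
  also have "\<dots> = (\<Sum>j\<le>d. coeff m j * z ^ j)"
  proof (rule sum.mono_neutral_left)
    show "\<forall>i\<in>{..d} - (*) p ` {..e}. coeff m i * z ^ i = 0"
    proof
      fix i assume i: "i \<in> {..d} - (*) p ` {..e}"
      have "\<not> p dvd i"
      proof
        assume "p dvd i"
        then obtain k where k: "i = p * k" by blast
        then have "k \<le> e" using i e p0 by simp
        then show False using i k by blast
      qed
      then show "coeff m i * z ^ i = 0" using zero by simp
    qed
  qed (use e in auto)
  also have "\<dots> = poly m z" by (simp add: poly_altdef d_def)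
  finally have root: "poly g (z ^ p) = 0" using m(2) by simp
  then show zp: "z ^ CHAR('a) \<in> alg_cl F" using alg_cl_iff[OF F] g g0 unfolding p_def by blast
  show "degree (min_poly F (z ^ CHAR('a))) < degree (min_poly F z)"
    using degree_min_poly_le[OF F zp g g0] root deg by (simp add: p_def d_def m_def)
qed

text \<open>
  The degree drops each time one passes from an inseparable element to its \<open>p\<close>-th power. In
  characteristic 0 the exponent \<open>CHAR('a) ^ n\<close> can only be 1, with \<open>n = 0\<close>: this is what the positivity
  condition is for, here and in the following lemmas.
\<close>

lemma separable_power:
  fixes F :: "'a::alg_closed_field set"
  assumes F: "subfield F \<Omega>"
  shows "z \<in> alg_cl F \<Longrightarrow> \<exists>n. 0 < CHAR('a) ^ n \<and> z ^ (CHAR('a) ^ n) \<in> sep_cl F"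
proof (induction "degree (min_poly F z)" arbitrary: z rule: less_induct)
  case less
  show ?case
  proof (cases "z \<in> sep_cl F")
    case True
    then show ?thesis by (intro exI[of _ 0]) simp
  next
    case False
    note * = inseparable_power[OF F less.prems False]
    obtain n where "0 < CHAR('a) ^ n" "(z ^ CHAR('a)) ^ (CHAR('a) ^ n) \<in> sep_cl F"
      using less.hyps[OF *(3,2)] by blast
    then show ?thesis using *(1) by (intro exI[of _ "Suc n"]) (simp add: power_mult)
  qed
qed

text \<open>
  If \<open>z = s(z\<^sup>p)\<close> with \<open>s\<close> over \<open>F\<close>, then the minimal polynomial of \<open>z\<close> divides \<open>T - s(T\<^sup>p)\<close>, whose
  derivative is 1. A polynomial with derivative zero can divide it only if it divides this derivative.
\<close>

lemma separable_of_mem_adjoin_power: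
  fixes F :: "'a::alg_closed_field set"
  assumes F: "subfield F \<Omega>" and z: "z \<in> alg_cl F" and q: "q = CHAR('a) ^ n" "0 < q"
    and "z ^ q \<in> sep_cl F" "z \<in> adjoin F (z ^ q)"
  shows "z \<in> sep_cl F"
proof (rule ccontr)
  assume ns: "z \<notin> sep_cl F"
  define p where "p = CHAR('a)"
  have "n \<noteq> 0" using ns assms by (cases n) auto
  then obtain k where "n = Suc k" by (cases n) auto
  then have "z ^ q = (z ^ p) ^ (p ^ k)" by (simp add: q p_def power_mult)
  then have "z ^ q \<in> adjoin F (z ^ p)"
    using sf_power[OF subfield_adjoin adjoin_mem] by metis
  then have "z \<in> adjoin F (z ^ p)"
    using adjoin_least[OF subfield_adjoin adjoin_incl] assms(6) by blast
  moreover have "z ^ p \<in> alg_cl F" by (rule sf_power[OF subfield_alg_cl[OF F] z])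
  ultimately obtain s where s: "s \<in> polys F" "z = poly s (z ^ p)" using adjoin_alg[OF F] by blast
  define h where "h = [:0, 1:] - pcompose s (monom 1 p)"
  have "h \<in> polys F"
    unfolding h_def by (intro polys_diff[OF F] polys_pcompose[OF F] s(1) polys_monom[OF F] polys_pCons[OF F] polys_0[OF F] sf_0[OF F] sf_1[OF F])
  moreover have "poly h z = 0" using s(2) by (simp add: h_def poly_pcompose poly_monom)
  ultimately obtain t where t: "h = min_poly F z * t" using min_poly_dvd[OF F z] by blast
  have "pderiv h = 1"
    by (simp add: h_def pderiv_diff pderiv_pcompose pderiv_monom pderiv_pCons p_def)
  moreover have "pderiv h = min_poly F z * pderiv t"
    unfolding t pderiv_mult using inseparable_pderiv[OF F z ns] by simp
  ultimately have "min_poly F z dvd 1" by (metis dvd_triv_left)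
  then have "degree (min_poly F z) \<le> degree (1 :: 'a poly)" by (rule dvd_imp_degree_le) simp
  then show False using degree_min_poly_pos[OF F z] by simp
qed

text \<open>
  Write \<open>w = g(c)\<close> with \<open>g\<close> of degree less than that of the minimal polynomial \<open>m\<close> of \<open>c\<close>. The polynomial
  \<open>g\<^sup>q - w\<^sup>q\<close> is over \<open>M\<close> and vanishes at \<open>c\<close>, hence at all roots of \<open>m\<close>. Since taking \<open>q\<close>-th powers is injective,
  \<open>g - w\<close> vanishes at all roots of \<open>m\<close>. These are simple, so \<open>m\<close> divides \<open>g - w\<close>, and by its degree
  this polynomial is zero.
\<close>

lemma mem_base_of_power:
  fixes M :: "'a::alg_closed_field set"
  assumes M: "subfield M \<Omega>" and c: "c \<in> sep_cl M" and w: "w \<in> adjoin M c"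
    and q: "q = CHAR('a) ^ n" "0 < q" and wq: "w ^ q \<in> M"
  shows "w \<in> M"
proof -
  define m where "m = min_poly M c"
  have ca: "c \<in> alg_cl M" using c sep_cl_alg_cl by blast
  obtain g where g: "g \<in> polys M" "g = 0 \<or> degree g < degree m" "w = poly g c"
    using adjoin_alg_reduced[OF M ca w] unfolding m_def by blast
  define G where "G = g ^ q - [:w ^ q:]"
  have "G \<in> polys M"
    unfolding G_def by (intro polys_diff[OF M] polys_power[OF M] g polys_pCons[OF M] wq polys_0[OF M])
  moreover have "poly G c = 0" by (simp add: G_def g(3))
  ultimately obtain t where t: "G = m * t" using min_poly_dvd[OF M ca] unfolding m_def by blast
  have "m dvd g - [:w:]"
  proof (rule rsquarefree_dvd_of_roots)
    show "rsquarefree m" using c by (simp add: sep_cl_def m_def)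
    fix b assume "poly m b = 0"
    then have "poly G b = 0" by (simp add: t)
    then have "(poly g b - w) ^ q = 0" by (simp add: G_def frobenius_diff[OF q])
    then show "poly (g - [:w:]) b = 0" by simp
  qed
  moreover have "degree (g - [:w:]) < degree m"
    using g(2) degree_min_poly_pos[OF M ca] by (intro degree_diff_less) (auto simp: m_def)
  ultimately have "g - [:w:] = 0" using dvd_imp_degree_le by (metis not_le)
  then have "w = coeff g 0" by (metis coeff_pCons_0 eq_iff_diff_eq_0)
  then show ?thesis using polysD[OF g(1)] by blast
qed

definition adjoins :: "'a::field set \<Rightarrow> 'a list \<Rightarrow> 'a set"
  where "adjoins F cs = fold (\<lambda>c E. adjoin E c) cs F"

lemma adjoins_simps [simp]: "adjoins F [] = F" "adjoins F (c # cs) = adjoins (adjoin F c) cs"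
  by (simp_all add: adjoins_def)

lemma subfield_adjoins: "subfield F \<Omega> \<Longrightarrow> subfield (adjoins F cs) \<Omega>"
  by (induction cs arbitrary: F) (simp_all add: subfield_adjoin)

lemma adjoins_incl: "F \<union> set cs \<subseteq> adjoins F cs"
proof (induction cs arbitrary: F)
  case (Cons c cs)
  then show ?case using Cons[of "adjoin F c"] adjoin_incl[of F c] adjoin_mem[of c F] by auto
qed simp

lemma adjoins_least: "subfield E \<Omega> \<Longrightarrow> F \<subseteq> E \<Longrightarrow> set cs \<subseteq> E \<Longrightarrow> adjoins F cs \<subseteq> E"
proof (induction cs arbitrary: F)
  case (Cons c cs)
  then show ?case using adjoin_least[of E F c] by simp
qed simp

lemma mem_base_of_power_list:
  fixes F :: "'a::alg_closed_field set"
  assumes q: "q = CHAR('a) ^ n" "0 < q"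
  shows "subfield F \<Omega> \<Longrightarrow> set cs \<subseteq> sep_cl F \<Longrightarrow> w \<in> adjoins F cs \<Longrightarrow> w ^ q \<in> F \<Longrightarrow> w \<in> F"
proof (induction cs arbitrary: F)
  case (Cons c cs)
  have "set cs \<subseteq> sep_cl (adjoin F c)"
    using Cons.prems(2) sep_cl_mono[OF Cons.prems(1) subfield_adjoin adjoin_incl] by auto
  then have "w \<in> adjoin F c"
    using Cons.IH[OF subfield_adjoin] Cons.prems(3,4) subsetD[OF adjoin_incl[of F c]] by simp
  then show ?case using mem_base_of_power[OF Cons.prems(1) _ _ q] Cons.prems(2,4) by (meson list.set_intros(1) subsetD)
qed simp

text \<open>
  Some power \<open>w\<^sup>q\<close> is separable over \<open>F\<close>. Over \<open>F(w\<^sup>q)\<close> the element \<open>w\<close> is purely inseparable and lies in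
  a field generated by separable elements, so it belongs to \<open>F(w\<^sup>q)\<close>.
\<close>

lemma adjoins_separable:
  fixes F :: "'a::alg_closed_field set"
  assumes F: "subfield F \<Omega>" and cs: "set cs \<subseteq> sep_cl F"
  shows "adjoins F cs \<subseteq> sep_cl F"
proof
  fix w assume w: "w \<in> adjoins F cs"
  have "adjoins F cs \<subseteq> alg_cl F"
    using adjoins_least[OF subfield_alg_cl[OF F] alg_cl_incl[OF F]] cs sep_cl_alg_cl by blast
  then have wa: "w \<in> alg_cl F" using w by blast
  obtain n where n: "0 < CHAR('a) ^ n" "w ^ (CHAR('a) ^ n) \<in> sep_cl F"
    using separable_power[OF F wa] by blast
  define E where "E = adjoin F (w ^ (CHAR('a) ^ n))"
  have E: "subfield E \<Omega>" "F \<subseteq> E" "w ^ (CHAR('a) ^ n) \<in> E"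
    unfolding E_def by (rule subfield_adjoin adjoin_incl adjoin_mem)+
  have "adjoins F cs \<subseteq> adjoins E cs"
    using adjoins_incl[of E cs] E(2) by (intro adjoins_least subfield_adjoins E) auto
  then have "w \<in> E"
    using mem_base_of_power_list[OF refl n(1) E(1), of cs w] cs sep_cl_mono[OF F E(1,2)] w E(3) by blast
  then show "w \<in> sep_cl F"
    unfolding E_def by (rule separable_of_mem_adjoin_power[OF F wa refl n])
qed

lemma subfield_sep_cl:
  fixes F :: "'a::alg_closed_field set"
  assumes F: "subfield F \<Omega>"
  shows "subfield (sep_cl F) \<Omega>"
proof -
  have *: "z \<in> adjoins F [z, w] \<and> w \<in> adjoins F [z, w]" for z w
    using adjoins_incl[of F "[z, w]"] by auto
  have sub: "adjoins F [z, w] \<subseteq> sep_cl F" if "z \<in> sep_cl F" "w \<in> sep_cl F" for z w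
    using adjoins_separable[OF F, of "[z, w]"] that by auto
  note sf = subfield_adjoins[OF F]
  show ?thesis
  proof (rule subfield_OmegaI)
    show "1 \<in> sep_cl F" using sep_cl_incl[OF F] sf_1[OF F] by blast
  next
    fix z w assume zw: "z \<in> sep_cl F" "w \<in> sep_cl F"
    show "z + w \<in> sep_cl F" "z * w \<in> sep_cl F"
      using subsetD[OF sub[OF zw]] sf_add[OF sf[of "[z, w]"]] sf_mult[OF sf[of "[z, w]"]] *[of z w] by simp_all
  next
    fix z assume z: "z \<in> sep_cl F"
    show "- z \<in> sep_cl F" "inverse z \<in> sep_cl F"
      using subsetD[OF sub[OF z z]] sf_uminus[OF sf[of "[z, z]"]] sf_inverse[OF sf[of "[z, z]"]] *[of z z] by simp_all
  qed
qed

text \<open>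
  The argument of \<open>adjoins_separable\<close>, with one more step at the top: \<open>y\<close> is separable over the field
  \<open>M\<close> generated by \<open>y\<^sup>q\<close> and the coefficients of its minimal polynomial over \<open>L\<close>.
\<close>

lemma sep_cl_tower:
  fixes F :: "'a::alg_closed_field set"
  assumes F: "subfield F \<Omega>" and L: "subfield L \<Omega>" "F \<subseteq> L" "L \<subseteq> sep_cl F"
  shows "sep_cl L \<subseteq> sep_cl F"
proof
  fix y assume y: "y \<in> sep_cl L"
  have yL: "y \<in> alg_cl L" using y sep_cl_alg_cl by blast
  have "alg_cl L = alg_cl F"
    using alg_cl_intermediate[OF F L(2)] L(3) sep_cl_alg_cl by blast
  then have ya: "y \<in> alg_cl F" using yL by blast
  obtain n where n: "0 < CHAR('a) ^ n" "y ^ (CHAR('a) ^ n) \<in> sep_cl F"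
    using separable_power[OF F ya] by blast
  define E where "E = adjoin F (y ^ (CHAR('a) ^ n))"
  have E: "subfield E \<Omega>" "F \<subseteq> E" "y ^ (CHAR('a) ^ n) \<in> E"
    unfolding E_def by (rule subfield_adjoin adjoin_incl adjoin_mem)+
  define p where "p = min_poly L y"
  define cs where "cs = coeffs p"
  have "set cs \<subseteq> L"
    using min_poly_polys[OF L(1) yL] by (auto simp: cs_def coeffs_def polys_def p_def)
  then have cs: "set cs \<subseteq> sep_cl E" using L(3) sep_cl_mono[OF F E(1,2)] by blast
  define M where "M = adjoins E cs"
  have M: "subfield M \<Omega>" "E \<subseteq> M" "set cs \<subseteq> M"
    unfolding M_def using subfield_adjoins[OF E(1)] adjoins_incl by blast+
  have "coeff p i \<in> M" for i
    using coeff_in_coeffs[of p i] min_poly_nonzero[OF L(1) yL] M(3) sf_0[OF M(1)]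
    by (cases "i \<le> degree p") (auto simp: coeff_eq_0 cs_def p_def)
  then have "p \<in> polys M" by (rule polysI)
  then have "y \<in> sep_cl M"
    using y min_poly_root[OF L(1) yL] by (intro sep_cl_of_root[OF M(1), of p]) (auto simp: sep_cl_def p_def)
  then have "y \<in> M"
    using mem_base_of_power[OF M(1) _ adjoin_mem refl n(1)] E(3) M(2) by blast
  then have "y \<in> E"
    unfolding M_def by (rule mem_base_of_power_list[OF refl n(1) E(1) cs _ E(3)])
  then show "y \<in> sep_cl F"
    unfolding E_def by (rule separable_of_mem_adjoin_power[OF F ya refl n])
qed

text \<open>
  The minimal polynomial \<open>g\<close> of \<open>y\<close> over \<open>K(x)\<close> divides the one over \<open>K\<close>, so its roots and hence its
  coefficients are algebraic over \<open>K\<close>. Those that lie in \<open>K(x)\<close> are elements of \<open>K\<close>; thus \<open>g\<close> is a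
  polynomial over \<open>K\<close>.
\<close>

lemma separable_descent:
  fixes K :: "'a::alg_closed_field set"
  assumes K: "subfield K \<Omega>" and x: "x \<notin> alg_cl K" and y: "y \<in> alg_cl K" "y \<in> sep_cl (adjoin K x)"
  shows "y \<in> sep_cl K"
proof -
  note E = subfield_adjoin[of K x]
  have ya: "y \<in> alg_cl (adjoin K x)" using y(2) sep_cl_alg_cl by blast
  define g where "g = min_poly (adjoin K x) y"
  have g: "g \<in> polys (adjoin K x)" "g \<noteq> 0" "poly g y = 0" "lead_coeff g = 1"
    unfolding g_def by (rule min_poly_polys[OF E ya] min_poly_nonzero[OF E ya] min_poly_root[OF E ya] min_poly_monic[OF E ya])+
  obtain h where h: "min_poly K y = g * h"
    using min_poly_dvd[OF E ya _ min_poly_root[OF K y(1)]] min_poly_polys[OF K y(1)] polys_mono[OF adjoin_incl]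
    unfolding g_def by blast
  have "b \<in> alg_cl K" if "poly g b = 0" for b
    using that h min_poly_polys[OF K y(1)] min_poly_nonzero[OF K y(1)] alg_cl_iff[OF K] by (metis mult_zero_left poly_mult)
  then have "g \<in> polys (alg_cl K)"
    using polys_of_roots[OF subfield_alg_cl[OF K] g(2)] g(4) sf_1[OF subfield_alg_cl[OF K]] by simp
  then have "g \<in> polys K" using g(1) alg_cl_Int_adjoin[OF K x] by (auto simp: polys_def)
  moreover have "rsquarefree g" using y(2) by (simp add: sep_cl_def g_def)
  ultimately show ?thesis using sep_cl_of_root[OF K] g(3) by blast
qed

section \<open>Valuations\<close>

lemma extended_add_less_cancel:
  fixes \<alpha> \<beta> \<delta> :: "'g::linordered_ab_group_add extended"
  assumes "\<delta> \<noteq> \<infinity>" "\<delta> \<noteq> -\<infinity>" "\<alpha> \<noteq> -\<infinity>" "\<beta> \<noteq> -\<infinity>"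
  shows "\<alpha> + \<delta> < \<beta> + \<delta> \<longleftrightarrow> \<alpha> < \<beta>"
  using assms by (cases \<alpha>; cases \<beta>; cases \<delta>) auto

locale valued =
  fixes v :: "'a::field \<Rightarrow> 'g::linordered_ab_group_add extended"
  assumes valuation: "valuation v"
begin

lemma v_ne_Minf: "v z \<noteq> -\<infinity>"
  and v_eq_Pinf_iff: "v z = \<infinity> \<longleftrightarrow> z = 0"
  and v_mult: "v (z * w) = v z + v w"
  and v_add: "min (v z) (v w) \<le> v (z + w)"
  using valuation by (simp_all add: valuation_def)

lemma v_0 [simp]: "v 0 = \<infinity>"
  by (simp add: v_eq_Pinf_iff)

lemma v_cases: obtains "z = 0" | g where "z \<noteq> 0" "v z = Fin g"
  using v_ne_Minf v_eq_Pinf_iff by (cases "v z") auto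

lemma v_le_Pinf: "v z \<le> \<infinity>"
  by (cases "v z") auto

lemma v_less_Pinf_iff: "v z < \<infinity> \<longleftrightarrow> z \<noteq> 0"
  using v_le_Pinf[of z] v_eq_Pinf_iff[of z] by (auto simp: less_le)

lemma v_1: "v 1 = 0"
proof -
  obtain g where g: "v 1 = Fin g" using v_cases[of 1] by auto
  then have "Fin g = Fin g + Fin g" using v_mult[of 1 1] by simp
  then show ?thesis using g by (simp add: zero_extended_def)
qed

lemma v_minus [simp]: "v (- z) = v z"
proof -
  obtain g where g: "v (- 1) = Fin g" using v_cases[of "- 1"] by auto
  then have "Fin g + Fin g = 0" using v_mult[of "- 1" "- 1"] v_1 by simp
  then have "g + g = 0" by (simp add: zero_extended_def)
  then have "v (- 1) = 0" using g by (simp add: zero_extended_def)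
  then show ?thesis using v_mult[of "- 1" z] by simp
qed

lemma v_diff_commute: "v (z - w) = v (w - z)"
  using v_minus[of "z - w"] by simp

lemma v_add_ge: "\<alpha> \<le> v z \<Longrightarrow> \<alpha> \<le> v w \<Longrightarrow> \<alpha> \<le> v (z + w)"
  using v_add[of z w] by (meson min.boundedI order_trans)

lemma v_diff_ge: "\<alpha> \<le> v z \<Longrightarrow> \<alpha> \<le> v w \<Longrightarrow> \<alpha> \<le> v (z - w)"
  using v_add_ge[of \<alpha> z "- w"] by simp

lemma v_add_gt: "\<alpha> < v z \<Longrightarrow> \<alpha> < v w \<Longrightarrow> \<alpha> < v (z + w)"
  using v_add[of z w] by (meson less_le_trans min_less_iff_conj)

lemma v_diff_gt: "\<alpha> < v z \<Longrightarrow> \<alpha> < v w \<Longrightarrow> \<alpha> < v (z - w)"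
  using v_add_gt[of \<alpha> z "- w"] by simp

lemma v_sum_gt: "\<alpha> < \<infinity> \<Longrightarrow> (\<And>i. i \<in> I \<Longrightarrow> \<alpha> < v (f i)) \<Longrightarrow> \<alpha> < v (sum f I)"
  by (induction I rule: infinite_finite_induct) (auto intro: v_add_gt)

lemma v_add_eq: "v z < v w \<Longrightarrow> v (z + w) = v z"
  using v_add[of z w] v_add[of "z + w" "- w"]
  by (metis add_diff_cancel_right' add_uminus_conv_diff antisym leD linear min.absorb1 min.absorb2 min.strict_order_iff v_minus)

lemma v_mult_less_iff: "w \<noteq> 0 \<Longrightarrow> v (z * w) < v (z' * w) \<longleftrightarrow> v z < v z'"
  unfolding v_mult by (rule extended_add_less_cancel) (simp_all add: v_ne_Minf v_eq_Pinf_iff)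

lemma v_mult_le_iff: "w \<noteq> 0 \<Longrightarrow> v (z * w) \<le> v (z' * w) \<longleftrightarrow> v z \<le> v z'"
  using v_mult_less_iff by (meson not_le)

lemma v_mult_le: "v z \<le> v z' \<Longrightarrow> v w \<le> v w' \<Longrightarrow> v (z * w) \<le> v (z' * w')"
  unfolding v_mult by (rule add_mono)

lemma v_mult_less: "v z < v z' \<Longrightarrow> v w \<le> v w' \<Longrightarrow> w \<noteq> 0 \<Longrightarrow> v (z * w) < v (z' * w')"
  using v_mult_less_iff[of w z z'] v_mult_le[of z' z' w w'] by (simp add: less_le_trans)

lemma v_eq_divide: "w \<noteq> 0 \<Longrightarrow> w' \<noteq> 0 \<Longrightarrow> v z = v z' \<Longrightarrow> v w = v w' \<Longrightarrow> v (z / w) = v (z' / w')"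
proof -
  assume a: "w \<noteq> 0" "w' \<noteq> 0" "v z = v z'" "v w = v w'"
  have "v (z / w * w) = v (z' / w' * w')" using a by simp
  also have "\<dots> = v (z' / w' * w)" using a(4) by (simp only: v_mult)
  finally have "v (z / w * w) = v (z' / w' * w)" .
  then show ?thesis using v_mult_le_iff[OF a(1)] by (metis antisym order_refl)
qed

lemma v_power_less: "v z < v w \<Longrightarrow> 0 < n \<Longrightarrow> v (z ^ n) < v (w ^ n)"
proof (induction n)
  case (Suc n)
  have "z \<noteq> 0" using Suc.prems(1) v_less_Pinf_iff v_le_Pinf less_le_trans by metis
  moreover have "v (z ^ n) \<le> v (w ^ n)" using Suc by (cases "n = 0") auto
  ultimately show ?case using v_mult_less[OF Suc.prems(1)] by simp
qed simp

lemma v_power_cancel: "v (z ^ n) = v (w ^ n) \<Longrightarrow> 0 < n \<Longrightarrow> v z = v w"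
  using v_power_less[of z w n] v_power_less[of w z n] by (metis less_irrefl linorder_less_linear)

text \<open>
  The value of a nonzero element as an element of the group \<open>'g\<close>, where values can be subtracted; the value 0
  at \<open>z = 0\<close> is a dummy.
\<close>

definition val :: "'a \<Rightarrow> 'g"
  where "val z = (case v z of Fin g \<Rightarrow> g | _ \<Rightarrow> 0)"

lemma v_eq_Fin_val: "z \<noteq> 0 \<Longrightarrow> v z = Fin (val z)"
  by (rule v_cases[of z]) (auto simp: val_def)

lemma val_mult: "z \<noteq> 0 \<Longrightarrow> w \<noteq> 0 \<Longrightarrow> val (z * w) = val z + val w"
  using v_mult[of z w] by (simp add: v_eq_Fin_val)

lemma v_eq_iff_val: "z \<noteq> 0 \<Longrightarrow> w \<noteq> 0 \<Longrightarrow> v z = v w \<longleftrightarrow> val z = val w"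
  by (simp add: v_eq_Fin_val)

subsection \<open>Elements with the same leading term\<close>

text \<open>
  For nonzero \<open>z\<close> this says that \<open>w / z\<close> is congruent to 1 modulo the maximal ideal, that is, \<open>z\<close>
  and \<open>w\<close> have the same image in the graded ring of the valuation. An automorphism belongs to the
  ramification group if and only if it moves every separable element to a close one.
\<close>

definition close :: "'a \<Rightarrow> 'a \<Rightarrow> bool"
  where "close z w \<longleftrightarrow> z = w \<or> v z < v (w - z)"

lemma close_refl: "close z z"
  by (simp add: close_def)

lemma close_v: "close z w \<Longrightarrow> v w = v z"
  using v_add_eq[of z "w - z"] by (auto simp: close_def)

lemma close_sym: "close z w \<Longrightarrow> close w z"
  using close_v[of z w] by (auto simp: close_def v_diff_commute)

lemma close_trans: "close z w \<Longrightarrow> close w u \<Longrightarrow> close z u"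
  using close_v[of z w] v_add_gt[of "v z" "w - z" "u - w"] by (auto simp: close_def)

lemma close_0_left: "close 0 w \<Longrightarrow> w = 0"
  using close_v[of 0 w] by (simp add: v_eq_Pinf_iff)

lemma close_mult:
  assumes "close z w" "close z' w'"
  shows "close (z * z') (w * w')"
proof -
  have 1: "close (z * u) (w * u)" if "close z w" for z w u
  proof (cases "u = 0")
    case False
    then show ?thesis using that v_mult_less_iff[OF False, of z "w - z"]
      by (auto simp: close_def algebra_simps)
  qed (simp add: close_refl)
  have "close (z * z') (w * z')" "close (z' * w) (w' * w)" using 1 assms by blast+
  then show ?thesis using close_trans by (simp add: mult.commute)
qed

lemma close_power: "close z w \<Longrightarrow> close (z ^ n) (w ^ n)"
  by (induction n) (auto intro: close_refl close_mult)

lemma close_divide: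
  assumes "close z w" "close z' w'"
  shows "close (z / z') (w / w')"
proof (cases "z' = 0")
  case True
  then have "w' = 0" using assms(2) close_0_left by blast
  then show ?thesis using True by (simp add: close_refl)
next
  case False
  then have "w' \<noteq> 0" using close_0_left close_sym assms(2) by blast
  have "close (z / z' * (inverse w' * z')) (z / z' * (inverse w' * w'))"
    using assms(2) by (intro close_mult close_refl)
  then have "close (z / w') (z / z')" using False \<open>w' \<noteq> 0\<close> by (simp add: field_simps)
  moreover have "close (z * inverse w') (w * inverse w')"
    using assms(1) by (intro close_mult close_refl)
  ultimately show ?thesis using close_trans close_sym by (metis divide_inverse)
qed

lemma minimal_term:
  fixes p :: "'a poly"
  assumes "p \<noteq> 0" "z \<noteq> 0"
  obtains k where "coeff p k \<noteq> 0"
    "\<And>i. v (coeff p k * z ^ k) \<le> v (coeff p i * z ^ i)"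
proof -
  define t where "t i = v (coeff p i * z ^ i)" for i
  obtain k where k: "k \<le> degree p" "\<And>i. i \<le> degree p \<Longrightarrow> t k \<le> t i"
    using arg_min_if_finite[of "{..degree p}" t]
    by (metis atMost_iff empty_iff finite_atMost le0 not_le)
  have "t k \<le> t (degree p)" using k by blast
  also have "\<dots> < \<infinity>" using assms by (simp add: t_def v_less_Pinf_iff)
  finally have nz: "coeff p k \<noteq> 0" by (auto simp: t_def)
  moreover have "t k \<le> t i" for i
    using k(2)[of i] v_le_Pinf by (cases "i \<le> degree p") (auto simp: t_def coeff_eq_0)
  ultimately show ?thesis using that unfolding t_def by blast
qed

text \<open>
  Changing the coefficients and the argument to close ones changes every term of the polynomial by a
  quantity whose value is larger than that of the term.
\<close>

lemma poly_perturbation: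
  fixes f f' :: "'a poly"
  assumes "\<And>i. close (coeff f i) (coeff f' i)" "close z w" "\<mu> < \<infinity>"
    and \<mu>: "\<And>i. \<mu> \<le> v (coeff f i * z ^ i)"
  shows "\<mu> < v (poly f' w - poly f z)"
proof -
  define n where "n = max (degree f) (degree f')"
  have "poly g u = (\<Sum>i\<le>n. coeff g i * u ^ i)" if "degree g \<le> n" for g :: "'a poly" and u
    unfolding poly_altdef by (rule sum.mono_neutral_left) (use that in \<open>auto simp: coeff_eq_0\<close>)
  then have eq: "poly f' w - poly f z =
      (\<Sum>i\<le>n. coeff f' i * w ^ i - coeff f i * z ^ i)"
    by (simp add: n_def sum_subtractf)
  have "\<mu> < v (coeff f' i * w ^ i - coeff f i * z ^ i)" for i
  proof -
    have "close (coeff f i * z ^ i) (coeff f' i * w ^ i)"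
      by (intro close_mult close_power assms)
    then show ?thesis using \<mu>[of i] assms(3) by (auto simp: close_def)
  qed
  then show ?thesis unfolding eq by (rule v_sum_gt[OF assms(3)])
qed

end

subsection \<open>Values of roots\<close>

lemma coeff_linear_mult:
  "coeff ([:- b, 1:] * q) i * z ^ i =
   (case i of 0 \<Rightarrow> 0 | Suc j \<Rightarrow> coeff q j * z ^ j * z) - b * (coeff q i * (z :: 'a::field) ^ i)"
  by (cases i) (simp_all add: algebra_simps)

locale valued_closed = valued v for v :: "'a::alg_closed_field \<Rightarrow> 'g::linordered_ab_group_add extended"
begin

lemma close_poly_of_roots:
  fixes p :: "'a poly"
  assumes "\<And>c. poly p c = 0 \<Longrightarrow> close (z - c) (w - c)"
  shows "close (poly p z) (poly p w)"
proof (cases "p = 0")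
  case False
  then have "(\<forall>c. poly p c = 0 \<longrightarrow> close (z - c) (w - c)) \<longrightarrow> close (poly p z) (poly p w)"
  proof (induction p rule: poly_linear_induct)
    case (linear b q)
    show ?case
    proof
      assume *: "\<forall>c. poly ([:- b, 1:] * q) c = 0 \<longrightarrow> close (z - c) (w - c)"
      then have "close ((z - b) * poly q z) ((w - b) * poly q w)"
        using linear by (intro close_mult) simp_all
      then show "close (poly ([:- b, 1:] * q) z) (poly ([:- b, 1:] * q) w)"
        unfolding poly_mult by simp
    qed
  qed (simp add: close_refl)
  then show ?thesis using assms by blast
qed (simp add: close_refl)

text \<open>
  The contrapositive is multiplicative. If \<open>v (z - y) \<le> v z\<close> for every root \<open>y\<close>, then each linear factor
  satisfies \<open>v (z - y) = min (v z) (v y)\<close>, so no cancellation occurs and \<open>v (p(z))\<close> is the minimum of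
  the values of the terms of \<open>p\<close> at \<open>z\<close>.
\<close>

lemma exists_close_root:
  fixes p :: "'a poly"
  assumes "v (coeff p i * z ^ i) < v (poly p z)" "p \<noteq> 0"
  obtains y where "poly p y = 0" "v z < v (z - y)"
proof -
  have "(\<forall>y. poly p y = 0 \<longrightarrow> v (z - y) \<le> v z) \<longrightarrow> (\<forall>i. v (poly p z) \<le> v (coeff p i * z ^ i))"
    using assms(2)
  proof (induction p rule: poly_linear_induct)
    case (const c)
    then show ?case using v_le_Pinf by (auto simp: coeff_pCons split: nat.splits)
  next
    case (linear b q)
    show ?case
    proof (intro impI allI)
      fix i assume *: "\<forall>y. poly ([:- b, 1:] * q) y = 0 \<longrightarrow> v (z - y) \<le> v z"
      then have q: "v (poly q z) \<le> v (coeff q j * z ^ j)" for j using linear by simp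
      have bz: "v (z - b) \<le> v z" using * by simp
      have b: "v (z - b) \<le> v b" using v_diff_ge[of "v (z - b)" z "z - b"] bz by simp
      have "v (poly q z * (z - b)) \<le> v (coeff q i * z ^ i * b)"
        using q b by (intro v_mult_le)
      moreover have "v (poly q z * (z - b)) \<le> v (coeff q j * z ^ j * z)" for j
        using q bz by (intro v_mult_le)
      ultimately have "v (poly q z * (z - b)) \<le> v (coeff ([:- b, 1:] * q) i * z ^ i)"
        unfolding coeff_linear_mult using v_le_Pinf
        by (intro v_diff_ge) (auto split: nat.splits simp: mult.commute)
      then show "v (poly ([:- b, 1:] * q) z) \<le> v (coeff ([:- b, 1:] * q) i * z ^ i)"
        by (simp add: algebra_simps)
    qed
  qed
  then show ?thesis using assms(1) that by (meson not_le)
qed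

text \<open>
  For nonzero \<open>z\<close> this means that \<open>v z\<close> is, up to sign, not a slope of the Newton polygon of \<open>p\<close>.
\<close>

definition dominated :: "'a \<Rightarrow> 'a poly \<Rightarrow> bool"
  where "dominated z p \<longleftrightarrow> (\<exists>m. coeff p m \<noteq> 0 \<and>
    (\<forall>i. i \<noteq> m \<longrightarrow> v (coeff p m * z ^ m) < v (coeff p i * z ^ i)))"

lemma dominated_nonroot:
  assumes "dominated z p" "z \<noteq> 0"
  shows "poly p z \<noteq> 0"
proof -
  obtain m where m: "coeff p m \<noteq> 0"
    "\<And>i. i \<noteq> m \<Longrightarrow> v (coeff p m * z ^ m) < v (coeff p i * z ^ i)"
    using assms(1) unfolding dominated_def by blast
  define t where "t i = coeff p i * z ^ i" for i
  have nz: "t m \<noteq> 0" using m(1) assms(2) by (simp add: t_def)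
  have "v (t m) < v (sum t ({..degree p} - {m}))"
    by (rule v_sum_gt) (use nz m(2) in \<open>auto simp: v_less_Pinf_iff t_def\<close>)
  then have "v (t m + sum t ({..degree p} - {m})) = v (t m)" by (rule v_add_eq)
  moreover have "m \<le> degree p" using m(1) by (rule le_degree)
  then have "poly p z = t m + sum t ({..degree p} - {m})"
    unfolding poly_altdef t_def by (subst sum.remove[of _ m]) auto
  ultimately show ?thesis using nz v_eq_Pinf_iff by metis
qed

text \<open>
  The terms of the product at \<open>z\<close> are \<open>t (i - 1) * z - t i * b\<close>, where \<open>t i\<close> are the terms of \<open>q\<close>. If \<open>v z < v b\<close>,
  multiplication by \<open>z\<close> moves the dominating index \<open>m\<close> to \<open>m + 1\<close>; otherwise \<open>b\<close> keeps it at \<open>m\<close>.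
\<close>

lemma dominated_linear_mult:
  assumes "dominated z q" "z \<noteq> 0" "v b \<noteq> v z"
  shows "dominated z ([:- b, 1:] * q)"
proof -
  define t where "t i = coeff q i * z ^ i" for i
  define T where "T i = coeff ([:- b, 1:] * q) i * z ^ i" for i
  define A where "A i = (case i of 0 \<Rightarrow> 0 | Suc j \<Rightarrow> t j * z)" for i
  have T: "T i = A i - t i * b" for i
    unfolding T_def A_def t_def coeff_linear_mult by (simp split: nat.splits)
  obtain m where m: "coeff q m \<noteq> 0" "\<And>i. i \<noteq> m \<Longrightarrow> v (t m) < v (t i)"
    using assms(1) unfolding dominated_def t_def by blast
  have tm: "t m \<noteq> 0" using m(1) assms(2) by (simp add: t_def)
  have m': "v (t m) \<le> v (t i)" for i using m(2)[of i] by (cases "i = m") auto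
  have *: "dominated z ([:- b, 1:] * q)" if "T k \<noteq> 0" "\<And>i. i \<noteq> k \<Longrightarrow> v (T k) < v (T i)" for k
    using that unfolding dominated_def T_def by (intro exI[of _ k]) auto
  show ?thesis
  proof (cases "v z < v b")
    case True
    have B: "v (t m * z) < v (t i * b)" for i
      using v_mult_less[OF True m'[of i] tm] by (simp add: mult.commute)
    have A: "v (t m * z) < v (A i)" if "i \<noteq> Suc m" for i
      using that m(2) v_mult_less_iff[OF assms(2)] tm assms(2)
      by (auto simp: A_def v_less_Pinf_iff split: nat.splits)
    have eq: "v (T (Suc m)) = v (t m * z)"
      using v_add_eq[of "t m * z" "- (t (Suc m) * b)"] B by (simp add: T A_def)
    then have "T (Suc m) \<noteq> 0" using tm assms(2) v_eq_Pinf_iff by (metis mult_eq_0_iff)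
    then show ?thesis by (rule *) (unfold eq, subst T, rule v_diff_gt; simp add: A B)
  next
    case False
    then have bz: "v b < v z" using assms(3) by simp
    then have b0: "b \<noteq> 0" by (auto simp flip: v_less_Pinf_iff intro: less_le_trans v_le_Pinf)
    have A: "v (t m * b) < v (A i)" for i
      using v_mult_less[OF bz m' tm] tm b0 by (auto simp: A_def mult.commute v_less_Pinf_iff split: nat.splits)
    have B: "v (t m * b) < v (t i * b)" if "i \<noteq> m" for i
      using v_mult_less_iff[OF b0] m(2) that by simp
    have eq: "v (T m) = v (t m * b)"
      using v_add_eq[of "- (t m * b)" "A m"] A by (simp add: T)
    then have "T m \<noteq> 0" using tm b0 v_eq_Pinf_iff by (metis mult_eq_0_iff)
    then show ?thesis by (rule *) (unfold eq, subst T, rule v_diff_gt; simp add: A B)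
  qed
qed

lemma dominated_of_roots:
  assumes "p \<noteq> 0" "z \<noteq> 0"
  shows "(\<forall>b. poly p b = 0 \<longrightarrow> v b \<noteq> v z) \<longrightarrow> dominated z p"
  using assms(1)
proof (induction p rule: poly_linear_induct)
  case (const c)
  then show ?case
    by (auto simp: dominated_def coeff_pCons v_less_Pinf_iff split: nat.splits intro!: exI[of _ 0])
next
  case (linear b q)
  show ?case
  proof
    assume "\<forall>c. poly ([:- b, 1:] * q) c = 0 \<longrightarrow> v c \<noteq> v z"
    then have "v b \<noteq> v z" "dominated z q" using linear by simp_all
    then show "dominated z ([:- b, 1:] * q)" using dominated_linear_mult assms(2) by blast
  qed
qed

text \<open>
  If no root of \<open>p'\<close> had the value of \<open>z\<close>, then \<open>p'\<close> would have a dominating term at \<open>z\<close>. This property depends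
  only on the values of the coefficients, so \<open>p\<close> would have one too, which is impossible at a root.
\<close>

lemma root_of_same_value:
  fixes p p' :: "'a poly"
  assumes "p \<noteq> 0" "poly p z = 0"
    and pp': "\<And>i. v (coeff p' i) = v (coeff p i)"
  obtains z' where "poly p' z' = 0" "v z' = v z"
proof (cases "z = 0")
  case True
  then have "coeff p 0 = 0" using assms(2) by (simp add: poly_0_coeff_0)
  then have "v (coeff p' 0) = \<infinity>" using pp' by simp
  then have "poly p' 0 = 0" by (simp add: poly_0_coeff_0 v_eq_Pinf_iff)
  then show ?thesis using that True by blast
next
  case False
  have "p' \<noteq> 0"
  proof
    assume "p' = 0"
    then have "v (lead_coeff p) = \<infinity>" using pp' by (metis coeff_0 v_0)
    then show False using assms(1) by (simp add: v_eq_Pinf_iff)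
  qed
  have "\<not> dominated z p" using dominated_nonroot assms(2) False by blast
  moreover have "coeff p' i \<noteq> 0 \<longleftrightarrow> coeff p i \<noteq> 0" for i
    using pp' v_eq_Pinf_iff by metis
  ultimately have "\<not> dominated z p'" using pp' by (simp add: dominated_def v_mult)
  then show ?thesis using dominated_of_roots[OF \<open>p' \<noteq> 0\<close> False] that by blast
qed

end

section \<open>Extending partial isomorphisms of valued fields\<close>

text \<open>
  Along the elements \<open>h\<^sup>n h'\<close> the homomorphism \<open>d\<close> takes the values \<open>n d(h) + d(h')\<close>. These are
  pairwise different if \<open>d(h)\<close> is not zero, as an ordered group has no torsion.
\<close>

lemma finite_zeros_of_iterate:
  fixes d :: "'h \<Rightarrow> 'g::linordered_ab_group_add"
  assumes H: "\<And>x y. x \<in> H \<Longrightarrow> y \<in> H \<Longrightarrow> m x y \<in> H \<and> d (m x y) = d x + d y"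
    and h: "h \<in> H" "h' \<in> H" "d h \<noteq> 0 \<or> d h' \<noteq> 0"
  shows "finite {n. d ((m h ^^ n) h') = 0}"
proof -
  have closed: "(m h ^^ n) h' \<in> H" for n by (induction n) (use H h in auto)
  have step: "d ((m h ^^ Suc n) h') = d h + d ((m h ^^ n) h')" for n
    using H[OF h(1) closed] by simp
  show ?thesis
  proof (cases "d h = 0")
    case True
    have "d ((m h ^^ n) h') = d h'" for n
    proof (induction n)
      case (Suc n)
      then show ?case using step[of n] True by simp
    qed simp
    then show ?thesis using True h(3) by simp
  next
    case False
    have "inj (\<lambda>n. d ((m h ^^ n) h'))"
    proof (cases "d h > 0")
      case True
      then have "strict_mono (\<lambda>n. d ((m h ^^ n) h'))"
        unfolding strict_mono_Suc_iff by (simp add: step del: funpow.simps)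
      then show ?thesis by (rule strict_mono_imp_inj_on)
    next
      case nle: False
      then have "d h < 0" using False by simp
      then have "strict_mono (\<lambda>n. - d ((m h ^^ n) h'))"
        unfolding strict_mono_Suc_iff by (simp add: step del: funpow.simps)
      then have "inj (\<lambda>n. - d ((m h ^^ n) h'))" by (rule strict_mono_imp_inj_on)
      then show ?thesis by (simp add: inj_def)
    qed
    then have "finite ((\<lambda>n. d ((m h ^^ n) h')) -` {0})" by (intro finite_vimageI) auto
    then show ?thesis by (simp add: vimage_def)
  qed
qed

text \<open>
  Finitely many nonzero homomorphisms \<open>d j\<close> into a torsion-free group have a common element at which none
  of them vanishes. This turns witnesses against each single conjugate into one witness
  against all conjugates.
\<close>

lemma avoid_kernels:
  fixes d :: "'j \<Rightarrow> 'h \<Rightarrow> 'g::linordered_ab_group_add"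
  assumes "finite J" "H \<noteq> {}"
    and H: "\<And>j x y. x \<in> H \<Longrightarrow> y \<in> H \<Longrightarrow> m x y \<in> H \<and> d j (m x y) = d j x + d j y"
    and "\<And>j. j \<in> J \<Longrightarrow> \<exists>x\<in>H. d j x \<noteq> 0"
  shows "\<exists>x\<in>H. \<forall>j\<in>J. d j x \<noteq> 0"
  using assms(1,4)
proof (induction J)
  case empty
  then show ?case using assms(2) by auto
next
  case (insert k J)
  then obtain h where h: "h \<in> H" "\<And>j. j \<in> J \<Longrightarrow> d j h \<noteq> 0" by auto
  obtain h' where h': "h' \<in> H" "d k h' \<noteq> 0" using insert.prems by blast
  have "finite {n. d j ((m h ^^ n) h') = 0}" if "j \<in> insert k J" for j
    using that h h' by (intro finite_zeros_of_iterate[of H m "d j"] H) auto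
  then have "finite (\<Union>j\<in>insert k J. {n. d j ((m h ^^ n) h') = 0})"
    using insert.hyps(1) by (intro finite_UN_I) auto
  then obtain n where "n \<notin> (\<Union>j\<in>insert k J. {n. d j ((m h ^^ n) h') = 0})"
    using ex_new_if_finite infinite_UNIV_nat by blast
  moreover have "(m h ^^ n) h' \<in> H" by (induction n) (use H h h' in auto)
  ultimately show ?case by blast
qed

context valued_closed
begin

lemma simple_ext_value:
  assumes r: "partial_iso r" and eq: "\<And>f f'. rel_poly r f f' \<Longrightarrow> v (poly f y) = v (poly f' y')"
  shows "partial_iso (simple_ext r y y')" "r \<subseteq> simple_ext r y y'" "(y, y') \<in> simple_ext r y y'"
    "\<And>a b. (a, b) \<in> simple_ext r y y' \<Longrightarrow> v a = v b"
proof -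
  have zeros: "poly f y = 0 \<longleftrightarrow> poly f' y' = 0" if "rel_poly r f f'" for f f'
    using eq[OF that] v_eq_Pinf_iff by metis
  show "partial_iso (simple_ext r y y')" "r \<subseteq> simple_ext r y y'" "(y, y') \<in> simple_ext r y y'"
    by (rule partial_iso_simple_ext[OF r zeros] simple_ext_incl[OF r zeros] simple_ext_mem[OF r zeros]; assumption)+
  fix a b assume "(a, b) \<in> simple_ext r y y'"
  then obtain f f' g g' where
    *: "rel_poly r f f'" "rel_poly r g g'" "poly g y \<noteq> 0" "a = poly f y / poly g y" "b = poly f' y' / poly g' y'"
    unfolding simple_ext_def by blast
  show "v a = v b"
    unfolding *(4,5) by (rule v_eq_divide) (use * eq zeros in blast)+
qed

text \<open>
  The images of \<open>z = f(y)\<close> under the extensions of \<open>r\<close> are the roots of the image \<open>h'\<close> of the minimal polynomial of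
  \<open>z\<close>, and some root \<open>z'\<close> of \<open>h'\<close> has the value of \<open>z\<close>. Extending \<open>r\<close> first by \<open>z \<mapsto> z'\<close> and then to \<open>y\<close> shows
  that \<open>z'\<close> is \<open>f'(y')\<close> for a conjugate \<open>y'\<close> of \<open>y\<close>.
\<close>

lemma value_of_conjugate:
  assumes r: "partial_iso r" and vr: "\<And>a b. (a, b) \<in> r \<Longrightarrow> v a = v b"
    and y: "y \<in> alg_cl (Domain r)" and m: "rel_poly r (min_poly (Domain r) y) m'"
    and f: "rel_poly r f f'"
  obtains y' where "poly m' y' = 0" "v (poly f' y') = v (poly f y)"
proof -
  note D = subfield_Domain[OF r]
  define z where "z = poly f y"
  have z: "z \<in> alg_cl (Domain r)"
    unfolding z_def using poly_in_subfield[OF subfield_alg_cl[OF D] _ y] polys_mono[OF alg_cl_incl[OF D]]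
      rel_poly_polys[OF f] by blast
  obtain h' where h': "rel_poly r (min_poly (Domain r) z) h'"
    using rel_poly_exists[OF min_poly_polys[OF D z] pi_0[OF r]] by blast
  obtain z' where z': "poly h' z' = 0" "v z' = v z"
    using root_of_same_value[OF min_poly_nonzero[OF D z] min_poly_root[OF D z], of h'] rel_polyD[OF h'] vr by metis
  obtain s where s: "partial_iso s" "r \<subseteq> s" "(z, z') \<in> s"
    using adjoin_conjugate[OF r z h' z'(1)] by metis
  note Ds = subfield_Domain[OF s(1)]
  have ys: "y \<in> alg_cl (Domain s)" using alg_cl_mono[OF Domain_mono[OF s(2)]] y by blast
  obtain q' where q': "rel_poly s (min_poly (Domain s) y) q'"
    using rel_poly_exists[OF min_poly_polys[OF Ds ys] pi_0[OF s(1)]] by blast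
  obtain y' where y': "poly q' y' = 0"
    using alg_closed_imp_poly_has_root[of q'] rel_poly_degree[OF s(1) q'] degree_min_poly_pos[OF Ds ys] by auto
  obtain t where t: "partial_iso t" "s \<subseteq> t" "(y, y') \<in> t"
    using adjoin_conjugate[OF s(1) ys q' y'] by metis
  have rt: "r \<subseteq> t" using s(2) t(2) by blast
  have "(0, poly m' y') \<in> t"
    using rel_poly_poly[OF t(1) rel_poly_mono[OF m rt] t(3)] min_poly_root[OF D y] by simp
  then have "poly m' y' = 0" by (rule pi_zero_left[OF t(1)])
  moreover have "(z, poly f' y') \<in> t"
    unfolding z_def by (rule rel_poly_poly[OF t(1) rel_poly_mono[OF f rt] t(3)])
  then have "poly f' y' = z'" using pi_single_valued[OF t(1)] s(3) t(2) by blast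
  ultimately show ?thesis using that z'(2) z_def by blast
qed

text \<open>
  By \<open>value_of_conjugate\<close> every single polynomial \<open>f\<close> admits a conjugate \<open>y'\<close> with \<open>v (f'(y')) = v (f(y))\<close>.
  One conjugate works for all \<open>f\<close>: otherwise \<open>avoid_kernels\<close>, applied to the homomorphisms
  \<open>f \<mapsto> v (f'(y')) - v (f(y))\<close>, yields a polynomial that admits none.
\<close>

lemma value_preserving_step:
  assumes r: "partial_iso r" and vr: "\<And>a b. (a, b) \<in> r \<Longrightarrow> v a = v b" and y: "y \<in> alg_cl (Domain r)"
  obtains s where "partial_iso s" "r \<subseteq> s" "y \<in> Domain s" "Domain s \<subseteq> alg_cl (Domain r)"
    "\<And>a b. (a, b) \<in> s \<Longrightarrow> v a = v b"
proof -
  note D = subfield_Domain[OF r]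
  obtain m' where m': "rel_poly r (min_poly (Domain r) y) m'"
    using rel_poly_exists[OF min_poly_polys[OF D y] pi_0[OF r]] by blast
  define R where "R = {y'. poly m' y' = 0}"
  have zeros: "poly f y = 0 \<longleftrightarrow> poly f' y' = 0" if "y' \<in> R" "rel_poly r f f'" for y' f f'
    using conjugate_zeros[OF r y m' _ that(2)] that(1) by (simp add: R_def)
  have "\<exists>y'\<in>R. \<forall>f f'. rel_poly r f f' \<longrightarrow> v (poly f y) = v (poly f' y')"
  proof (rule ccontr)
    assume neg: "\<not> ?thesis"
    define H where "H = {(f, f'). rel_poly r f f' \<and> poly f y \<noteq> 0}"
    \<comment> \<open>The value 0 for indices outside \<open>R\<close> makes \<open>d\<close> additive for every index.\<close>
    define d where "d y' = (\<lambda>(f, f'). if y' \<in> R then val (poly f' y') - val (poly f y) else 0)" for y'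
    have "m' \<noteq> 0"
      using rel_poly_monic[OF r m' min_poly_monic[OF D y]] by auto
    have "\<exists>h\<in>H. \<forall>y'\<in>R. d y' h \<noteq> 0"
    proof (rule avoid_kernels[where m = "\<lambda>(f, f') (g, g'). (f * g, f' * g')"])
      show "finite R" unfolding R_def by (rule poly_roots_finite[OF \<open>m' \<noteq> 0\<close>])
      have "(1, 1) \<in> H" by (simp add: H_def rel_poly_1[OF r])
      then show "H \<noteq> {}" by blast
    next
      fix y' h k assume "h \<in> H" "k \<in> H"
      then show "(case h of (f, f') \<Rightarrow> \<lambda>(g, g'). (f * g, f' * g')) k \<in> H \<and>
          d y' ((case h of (f, f') \<Rightarrow> \<lambda>(g, g'). (f * g, f' * g')) k) = d y' h + d y' k"
        using rel_poly_mult[OF r] zeros by (auto simp: H_def d_def val_mult split: prod.splits)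
    next
      fix y' assume y': "y' \<in> R"
      then obtain f f' where f: "rel_poly r f f'" "v (poly f y) \<noteq> v (poly f' y')" using neg by blast
      have "poly f y \<noteq> 0" using f(2) zeros[OF y' f(1)] by metis
      moreover have "poly f' y' \<noteq> 0" using \<open>poly f y \<noteq> 0\<close> zeros[OF y' f(1)] by blast
      ultimately have "(f, f') \<in> H" "d y' (f, f') \<noteq> 0" using f y' by (auto simp: H_def d_def v_eq_iff_val)
      then show "\<exists>h\<in>H. d y' h \<noteq> 0" by blast
    qed
    then obtain f f' where f: "rel_poly r f f'" "\<And>y'. y' \<in> R \<Longrightarrow> val (poly f' y') \<noteq> val (poly f y)"
      by (auto simp: H_def d_def)
    obtain y' where "y' \<in> R" "v (poly f' y') = v (poly f y)"
      using value_of_conjugate[OF r vr y m' f(1)] by (auto simp: R_def)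
    then show False using f(2) by (metis val_def)
  qed
  then obtain y' where y': "y' \<in> R" "\<And>f f'. rel_poly r f f' \<Longrightarrow> v (poly f y) = v (poly f' y')" by blast
  show ?thesis
  proof (rule that)
    show "Domain (simple_ext r y y') \<subseteq> alg_cl (Domain r)"
      using Domain_simple_ext[OF r zeros[OF y'(1)] y] by blast
    show "y \<in> Domain (simple_ext r y y')" using simple_ext_value(3)[OF r y'(2)] by blast
  qed (use simple_ext_value[OF r y'(2)] in blast)+
qed

theorem value_preserving_extension:
  assumes r: "partial_iso r" and vr: "\<And>a b. (a, b) \<in> r \<Longrightarrow> v a = v b"
  obtains s where "partial_iso s" "r \<subseteq> s" "Domain s = alg_cl (Domain r)" "\<And>a b. (a, b) \<in> s \<Longrightarrow> v a = v b"
proof -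
  obtain s where s: "r \<subseteq> s" "partial_iso s" "Domain s \<subseteq> alg_cl (Domain r)" "\<And>a b. (a, b) \<in> s \<Longrightarrow> v a = v b"
    and max: "\<And>t. s \<subseteq> t \<Longrightarrow> partial_iso t \<Longrightarrow> Domain t \<subseteq> alg_cl (Domain r) \<Longrightarrow>
      (\<And>a b. (a, b) \<in> t \<Longrightarrow> v a = v b) \<Longrightarrow> t = s"
    using partial_iso_maximal[OF r, of "\<lambda>a b. v a = v b"] vr by metis
  have cl: "alg_cl (Domain s) = alg_cl (Domain r)"
    by (rule alg_cl_intermediate[OF subfield_Domain[OF r] Domain_mono[OF s(1)] s(3)])
  have "y \<in> Domain s" if y: "y \<in> alg_cl (Domain r)" for y
  proof -
    obtain t where "partial_iso t" "s \<subseteq> t" "y \<in> Domain t" "Domain t \<subseteq> alg_cl (Domain s)"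
      "\<And>a b. (a, b) \<in> t \<Longrightarrow> v a = v b"
      using value_preserving_step[OF s(2,4), of y] y cl by metis
    then show ?thesis using max[of t] cl by simp
  qed
  then show ?thesis using that s by blast
qed

subsection \<open>Preserving leading terms\<close>

text \<open>
  Among the elements close to \<open>z\<close> take \<open>y\<close> of least degree over the domain of \<open>r\<close>. A polynomial of smaller degree
  has no root close to \<open>z\<close>, so its value at \<open>z\<close> is the minimum of the values of its terms, and its leading term
  does not change when \<open>z\<close> is replaced by something close. The minimal polynomial \<open>m\<close> of \<open>y\<close> has unusually
  large value at \<open>z\<close>; then so has its image \<open>m'\<close>, which therefore has a root \<open>y'\<close> close to \<open>z\<close> as well.
  Mapping \<open>y\<close> to \<open>y'\<close> sends \<open>f(y)\<close> to \<open>f'(y')\<close>, and both are close to \<open>f(z)\<close>.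
\<close>

lemma close_step:
  assumes r: "partial_iso r" and cr: "\<And>a b. (a, b) \<in> r \<Longrightarrow> close a b"
    and z: "z \<in> alg_cl (Domain r)" "z \<noteq> 0"
  obtains s y where "partial_iso s" "r \<subseteq> s" "Domain s \<subseteq> alg_cl (Domain r)" "\<And>a b. (a, b) \<in> s \<Longrightarrow> close a b"
    "y \<in> Domain s" "v z < v (z - y)"
proof -
  note D = subfield_Domain[OF r]
  define Y where "Y y \<longleftrightarrow> y \<in> alg_cl (Domain r) \<and> v z < v (z - y)" for y
  have "Y z" using z by (simp add: Y_def v_less_Pinf_iff)
  then obtain y where y: "Y y" and
    least: "\<And>c. Y c \<Longrightarrow> degree (min_poly (Domain r) y) \<le> degree (min_poly (Domain r) c)"
    using ex_has_least_nat[of Y z "\<lambda>c. degree (min_poly (Domain r) c)"] by blast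
  define m where "m = min_poly (Domain r) y"
  have ya: "y \<in> alg_cl (Domain r)" and vy: "v z < v (z - y)" using y by (auto simp: Y_def)
  have zy: "close z y" using vy by (simp add: close_def v_diff_commute)
  have m: "m \<in> polys (Domain r)" "m \<noteq> 0" "poly m y = 0" "lead_coeff m = 1"
    unfolding m_def by (rule min_poly_polys[OF D ya] min_poly_nonzero[OF D ya] min_poly_root[OF D ya] min_poly_monic[OF D ya])+
  obtain m' where m': "rel_poly r m m'" using rel_poly_exists[OF m(1) pi_0[OF r]] by blast
  have close_coeff: "close (coeff f i) (coeff f' i)" if "rel_poly r f f'" for f f' i
    using rel_polyD[OF that] cr by blast
  obtain k where k: "coeff m k \<noteq> 0" "\<And>i. v (coeff m k * z ^ k) \<le> v (coeff m i * z ^ i)"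
    using minimal_term[OF m(2) z(2)] by blast
  define \<mu> where "\<mu> = v (coeff m k * z ^ k)"
  have \<mu>: "\<mu> < \<infinity>" using k(1) z(2) by (simp add: \<mu>_def v_less_Pinf_iff)
  have "\<mu> < v (poly m y - poly m z)"
    by (rule poly_perturbation[OF close_refl zy \<mu>]) (simp add: \<mu>_def k)
  then have 1: "\<mu> < v (poly m z)" using m(3) by simp
  have "\<mu> < v (poly m' z - poly m z)"
    by (rule poly_perturbation[OF close_coeff[OF m'] close_refl \<mu>]) (simp add: \<mu>_def k)
  then have "\<mu> < v (poly m' z)" using 1 v_add_gt[of \<mu> "poly m' z - poly m z" "poly m z"] by simp
  moreover have "v (coeff m' k * z ^ k) = \<mu>"
    using close_v[OF close_coeff[OF m', of k]] by (simp add: \<mu>_def v_mult)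
  moreover have "m' \<noteq> 0" using rel_poly_monic[OF r m' m(4)] by auto
  ultimately obtain y' where y': "poly m' y' = 0" "v z < v (z - y')" using exists_close_root by metis
  have zy': "close z y'" using y'(2) by (simp add: close_def v_diff_commute)
  have small: "close (poly f z) (poly f' w)"
    if f: "rel_poly r f g" "f \<noteq> 0" "degree f < degree m" and f': "f' = f \<or> f' = g" and w: "close z w" for f f' g w
  proof -
    have le: "v (poly f z) \<le> v (coeff f i * z ^ i)" for i
    proof (rule ccontr)
      assume "\<not> ?thesis"
      then have "v (coeff f i * z ^ i) < v (poly f z)" by simp
      from exists_close_root[OF this f(2)] obtain c where c: "poly f c = 0" "v z < v (z - c)" by blast
      have "c \<in> alg_cl (Domain r)" using c(1) f(2) rel_poly_polys[OF f(1)] alg_cl_iff[OF D] by blast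
      then have "degree m \<le> degree f"
        using least[of c] c(2) degree_min_poly_le[OF D _ rel_poly_polys[OF f(1)] f(2) c(1)]
        by (force simp: Y_def m_def)
      then show False using f(3) by simp
    qed
    obtain j where "coeff f j \<noteq> 0" using f(2) by (metis leading_coeff_0_iff)
    then have "v (poly f z) < \<infinity>"
      using le[of j] z(2) by (metis le_less_trans mult_eq_0_iff power_not_zero v_less_Pinf_iff)
    then have "v (poly f z) < v (poly f' w - poly f z)"
      using f' close_coeff[OF f(1)] close_refl w le by (intro poly_perturbation) auto
    then show ?thesis by (simp add: close_def)
  qed
  \<comment> \<open>Modulo \<open>m\<close> every polynomial is one of smaller degree.\<close>
  have close_all: "close (poly f y) (poly f' y')" if f: "rel_poly r f f'" for f f'
  proof -
    obtain q s where qs: "q \<in> polys (Domain r)" "s \<in> polys (Domain r)" "f = m * q + s"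
      "s = 0 \<or> degree s < degree m"
      using polys_monic_division[OF D m(1,4) rel_poly_polys[OF f]] by blast
    obtain q' where q': "rel_poly r q q'" using rel_poly_exists[OF qs(1) pi_0[OF r]] by blast
    obtain s' where s': "rel_poly r s s'" using rel_poly_exists[OF qs(2) pi_0[OF r]] by blast
    have "rel_poly r f (m' * q' + s')"
      unfolding qs(3) by (intro rel_poly_add[OF r] rel_poly_mult[OF r] m' q' s')
    then have "f' = m' * q' + s'" using rel_poly_unique[OF r f] by blast
    then have *: "poly f y = poly s y" "poly f' y' = poly s' y'" using qs(3) m(3) y'(1) by simp_all
    show ?thesis
    proof (cases "s = 0")
      case True
      then have "s' = 0" using rel_poly_unique[OF r s'] rel_poly_0[OF r] by blast
      then show ?thesis using True * by (simp add: close_refl)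
    next
      case False
      then have "close (poly s z) (poly s y)" "close (poly s z) (poly s' y')"
        using small[OF s'] qs(4) zy zy' by blast+
      then show ?thesis unfolding * using close_sym close_trans by blast
    qed
  qed
  have eq: "v (poly f y) = v (poly f' y')" if "rel_poly r f f'" for f f'
    using close_v[OF close_all[OF that]] by simp
  have zeros: "poly f y = 0 \<longleftrightarrow> poly f' y' = 0" if "rel_poly r f f'" for f f'
    using eq[OF that] v_eq_Pinf_iff by metis
  show ?thesis
  proof (rule that[OF simple_ext_value(1,2)[OF r eq]])
    show "Domain (simple_ext r y y') \<subseteq> alg_cl (Domain r)"
      using Domain_simple_ext[OF r zeros ya] by blast
    show "y \<in> Domain (simple_ext r y y')" using simple_ext_value(3)[OF r eq] by blast
    show "v z < v (z - y)" by (rule vy)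
    fix a b assume "(a, b) \<in> simple_ext r y y'"
    then show "close a b" unfolding simple_ext_def using close_divide close_all by blast
  qed
qed

text \<open>
  In a maximal extension \<open>s\<close> every \<open>z\<close> that is algebraic over the domain is close to some \<open>c\<close> in the domain, by
  \<open>close_step\<close>. Any extension \<open>t\<close> of \<open>s\<close> that preserves the values then maps \<open>z\<close> to something close
  to \<open>z\<close>, since \<open>z - c\<close> is mapped to an element of the same value and \<open>c\<close> to a close one.
\<close>

theorem close_extension:
  assumes r: "partial_iso r" and cr: "\<And>a b. (a, b) \<in> r \<Longrightarrow> close a b"
  obtains s where "partial_iso s" "r \<subseteq> s" "Domain s = alg_cl (Domain r)" "\<And>a b. (a, b) \<in> s \<Longrightarrow> close a b"
proof -
  obtain s where s: "r \<subseteq> s" "partial_iso s" "Domain s \<subseteq> alg_cl (Domain r)" "\<And>a b. (a, b) \<in> s \<Longrightarrow> close a b"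
    and max: "\<And>t. s \<subseteq> t \<Longrightarrow> partial_iso t \<Longrightarrow> Domain t \<subseteq> alg_cl (Domain r) \<Longrightarrow>
      (\<And>a b. (a, b) \<in> t \<Longrightarrow> close a b) \<Longrightarrow> t = s"
    using partial_iso_maximal[OF r, of close] cr by metis
  have cl: "alg_cl (Domain s) = alg_cl (Domain r)"
    by (rule alg_cl_intermediate[OF subfield_Domain[OF r] Domain_mono[OF s(1)] s(3)])
  have approx: "\<exists>c\<in>Domain s. v z < v (z - c)" if z: "z \<in> alg_cl (Domain s)" "z \<noteq> 0" for z
  proof -
    obtain t y where t: "partial_iso t" "s \<subseteq> t" "Domain t \<subseteq> alg_cl (Domain s)" "\<And>a b. (a, b) \<in> t \<Longrightarrow> close a b"
      "y \<in> Domain t" "v z < v (z - y)"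
      using close_step[OF s(2,4) z] by metis
    then have "t = s" using max[of t] cl by simp
    then show ?thesis using t by blast
  qed
  obtain t where t: "partial_iso t" "s \<subseteq> t" "Domain t = alg_cl (Domain s)" "\<And>a b. (a, b) \<in> t \<Longrightarrow> v a = v b"
    using value_preserving_extension[OF s(2)] close_v[OF s(4)] by metis
  have "close z w" if zw: "(z, w) \<in> t" for z w
  proof (cases "z = 0")
    case True
    then have "w = 0" using zw pi_zero_left[OF t(1)] by blast
    then show ?thesis using True by (simp add: close_refl)
  next
    case False
    then obtain c c' where c: "(c, c') \<in> s" "v z < v (z - c)" using approx[of z] zw t(3) by blast
    have "(z - c, w - c') \<in> t" using pi_diff[OF t(1)] zw c(1) t(2) by blast
    then have "v z < v (w - c')" using t(4) c(2) by metis
    moreover have "close z c" using c(2) by (simp add: close_def v_diff_commute)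
    then have "close z c'" using s(4)[OF c(1)] close_trans by blast
    then have "z = c' \<or> v z < v (c' - z)" by (simp add: close_def)
    ultimately show ?thesis using v_add_gt[of "v z" "w - c'" "c' - z"] by (auto simp: close_def)
  qed
  then show ?thesis using that[of t] t s(1) cl by blast
qed

end

section \<open>Minimal pairs and the implicit constant field\<close>

lemma subfield_ramification_field:
  fixes K :: "'a::alg_closed_field set"
  assumes K: "subfield K \<Omega>"
  shows "subfield (ramification_field v K) \<Omega>"
proof -
  note S = subfield_sep_cl[OF K]
  have fix_ops: "\<sigma> 1 = 1 \<and> (\<sigma> z = z \<longrightarrow> \<sigma> w = w \<longrightarrow> \<sigma> (z + w) = z + w \<and> \<sigma> (z * w) = z * w)
      \<and> (\<sigma> z = z \<longrightarrow> \<sigma> (- z) = - z \<and> \<sigma> (inverse z) = inverse z)"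
    if "\<sigma> \<in> Gal K" "z \<in> sep_cl K" "w \<in> sep_cl K" for \<sigma> z w
  proof -
    define r where "r = {(z, \<sigma> z) | z. z \<in> alg_cl K}"
    have r: "partial_iso r" unfolding r_def by (rule Gal_graph_alg_cl[OF K that(1)])
    have r_iff: "(a, b) \<in> r \<longleftrightarrow> a \<in> alg_cl K \<and> \<sigma> a = b" for a b by (auto simp: r_def)
    have "(z, \<sigma> z) \<in> r" "(w, \<sigma> w) \<in> r" using that sep_cl_alg_cl by (auto simp: r_def)
    then show ?thesis
      using pi_1[OF r] pi_add[OF r] pi_mult[OF r] pi_uminus[OF r] pi_inverse[OF r] unfolding r_iff by metis
  qed
  show ?thesis
    by (rule subfield_OmegaI; simp add: ramification_field_def sf_intros[OF S])
       (use fix_ops sf_1[OF S] in blast)+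
qed

context valued_closed
begin

text \<open>
  The groups in the definitions only ask for conditions on separable elements; every algebraic element
  has a power that is separable, and the value of the power determines the value of the element.
\<close>

lemma Gal_value_preserving:
  assumes F: "subfield F \<Omega>" and \<sigma>: "\<sigma> \<in> Gal F" and eq: "\<forall>y\<in>sep_cl F. v (\<sigma> y) = v y" and z: "z \<in> alg_cl F"
  shows "v (\<sigma> z) = v z"
proof -
  obtain n where n: "0 < CHAR('a) ^ n" "z ^ (CHAR('a) ^ n) \<in> sep_cl F"
    using separable_power[OF F z] by blast
  define q where "q = CHAR('a) ^ n"
  have "(z ^ q, \<sigma> z ^ q) \<in> {(z, \<sigma> z) | z. z \<in> alg_cl F}"
    using z by (intro pi_power[OF Gal_graph_alg_cl[OF F \<sigma>]]) auto
  then have "\<sigma> z ^ q = \<sigma> (z ^ q)" by blast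
  then have "v (\<sigma> z ^ q) = v (z ^ q)" using eq n(2) by (simp add: q_def)
  then show ?thesis using v_power_cancel n(1) unfolding q_def by blast
qed

end

locale minimal_pair_of_definition = valued_closed v
  for v :: "'a::alg_closed_field \<Rightarrow> 'g::linordered_ab_group_add extended" +
  fixes K x a \<gamma>
  assumes K: "subfield K \<Omega>" and x: "x \<notin> alg_cl K" and closure: "alg_cl (adjoin K x) = UNIV"
    and pair: "minimal_pair v K x a \<gamma>"
begin

lemma a: "a \<in> alg_cl K"
  and v_x_a: "v (x - a) = Fin \<gamma>"
  and v_max: "c \<in> alg_cl K \<Longrightarrow> v (x - c) \<le> Fin \<gamma>"
  and minimal: "b \<in> alg_cl K \<Longrightarrow> Fin \<gamma> \<le> v (a - b) \<Longrightarrow>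
    degree (min_poly K a) \<le> degree (min_poly K b)"
  using pair ext_degree_adjoin[OF K] unfolding minimal_pair_def by auto

lemma Ka: "subfield (adjoin K a) \<Omega>" "K \<subseteq> adjoin K a" "adjoin K a \<subseteq> alg_cl K" "alg_cl (adjoin K a) = alg_cl K"
proof -
  show sub: "subfield (adjoin K a) \<Omega>" "K \<subseteq> adjoin K a" by (rule subfield_adjoin adjoin_incl)+
  show "adjoin K a \<subseteq> alg_cl K" by (rule adjoin_least[OF subfield_alg_cl[OF K] alg_cl_incl[OF K] a])
  then show "alg_cl (adjoin K a) = alg_cl K" by (rule alg_cl_intermediate[OF K sub(2)])
qed

lemma v_x_minus:
  assumes c: "c \<in> alg_cl K"
  shows "v (x - c) = min (Fin \<gamma>) (v (a - c))"
proof (cases "v (a - c) < Fin \<gamma>")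
  case True
  then show ?thesis using v_add_eq[of "a - c" "x - a"] v_x_a by simp
next
  case False
  then have "Fin \<gamma> \<le> v (x - c)" using v_add_ge[of "Fin \<gamma>" "x - a" "a - c"] v_x_a by simp
  then show ?thesis using v_max[OF c] False by simp
qed

text \<open>
  An automorphism \<open>\<sigma>\<close> in the decomposition group of \<open>K(a)\<close> is extended to one in the decomposition group of
  \<open>K(x)\<close>, which fixes \<open>y\<close> by assumption.
\<close>

lemma implicit_constant_field_upper: "implicit_constant_field v K x \<subseteq> henselization v (adjoin K a)"
proof
  fix y assume "y \<in> implicit_constant_field v K x"
  then have y: "y \<in> alg_cl K" "y \<in> sep_cl (adjoin K x)"
    and fixed: "\<And>\<tau>. \<tau> \<in> Gal (adjoin K x) \<Longrightarrow> \<forall>z\<in>sep_cl (adjoin K x). v (\<tau> z) = v z \<Longrightarrow> \<tau> y = y"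
    by (auto simp: implicit_constant_field_def henselization_def)
  have "y \<in> sep_cl (adjoin K a)"
    using separable_descent[OF K x y] sep_cl_mono[OF K Ka(1,2)] by blast
  moreover have "\<sigma> y = y" if \<sigma>: "\<sigma> \<in> Gal (adjoin K a)" and "\<forall>z\<in>sep_cl (adjoin K a). v (\<sigma> z) = v z" for \<sigma>
  proof -
    have v\<sigma>: "v (\<sigma> z) = v z" if "z \<in> alg_cl K" for z
      using Gal_value_preserving[OF Ka(1) \<sigma>] that Ka(4) \<open>\<forall>z\<in>_. _\<close> by blast
    define r where "r = {(z, \<sigma> z) | z. z \<in> alg_cl K}"
    have r: "partial_iso r" unfolding r_def using Gal_graph_alg_cl[OF Ka(1) \<sigma>] Ka(4) by simp
    have Dr: "Domain r = alg_cl K" by (auto simp: r_def)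
    have r_fix: "(z, z) \<in> r" if "z \<in> adjoin K a" for z
      using that Gal_fixes[OF Ka(1) \<sigma>] Ka(3) by (force simp: r_def)
    have vr: "v (x - b) = v (x - b')" if "(b, b') \<in> r" for b b'
    proof -
      have "(a - b, a - b') \<in> r" by (rule pi_diff[OF r r_fix[OF adjoin_mem] that])
      then have "v (a - b) = v (a - b')" using v\<sigma> by (auto simp: r_def)
      moreover have "b \<in> alg_cl K" "b' \<in> alg_cl K"
        using that Gal_closed[OF Ka(1) \<sigma>] Ka(4) by (auto simp: r_def)
      ultimately show ?thesis using v_x_minus by simp
    qed
    \<comment> \<open>Both sides factor into linear polynomials whose roots correspond under \<open>\<sigma>\<close>.\<close>
    have eq: "v (poly f x) = v (poly f' x)" if "rel_poly r f f'" for f f'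
      using that
    proof (induction "degree f" arbitrary: f f')
      case 0
      then obtain c where c: "f = [:c:]" by (metis degree_eq_zeroE)
      have "degree f' = 0" using rel_poly_degree[OF r "0.prems"] 0 by simp
      then obtain c' where c': "f' = [:c':]" by (metis degree_eq_zeroE)
      have "(c, c') \<in> r" using rel_polyD[OF "0.prems", of 0] c c' by simp
      then show ?case using v\<sigma> by (auto simp: r_def c c')
    next
      case (Suc n)
      have f: "f \<in> polys (alg_cl K)" "f \<noteq> 0" using rel_poly_polys[OF Suc.prems] Dr Suc.hyps(2) by auto
      obtain b where b: "poly f b = 0" using alg_closed_imp_poly_has_root[of f] Suc.hyps(2) by auto
      then have bC: "b \<in> alg_cl K" using f alg_cl_iff[OF subfield_alg_cl[OF K]] alg_cl_idem[OF K] by blast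
      then have bb: "(b, \<sigma> b) \<in> r" by (auto simp: r_def)
      obtain q where q: "f = [:- b, 1:] * q" using b by (metis dvdE poly_eq_0_iff_dvd)
      have lin: "rel_poly r [:- b, 1:] [:- \<sigma> b, 1:]"
        by (intro rel_poly_pCons[OF r] pi_uminus[OF r] bb pi_1[OF r] rel_poly_0[OF r])
      have "[:- b, 1:] \<in> polys (alg_cl K)" using rel_poly_polys[OF lin] Dr by simp
      then have "q \<in> polys (alg_cl K)"
        by (rule polys_quotient[OF subfield_alg_cl[OF K]]) (use f(1) q in simp_all)
      then obtain q' where q': "rel_poly r q q'" "f' = [:- \<sigma> b, 1:] * q'"
        using rel_poly_dvd[OF r lin Suc.prems q] Dr by auto
      have "n = degree q"
        using Suc.hyps(2) q f(2) by (auto simp: degree_mult_eq simp del: mult_pCons_left)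
      then have "v (poly q x) = v (poly q' x)" using Suc.hyps(1) q'(1) by blast
      then have "v ((x - b) * poly q x) = v ((x - \<sigma> b) * poly q' x)" using vr[OF bb] by (simp add: v_mult)
      then show ?case unfolding q q'(2) poly_mult by simp
    qed
    define s where "s = simple_ext r x x"
    note s = simple_ext_value[OF r eq, folded s_def]
    have "subfield {z. (z, z) \<in> s} \<Omega>"
      by (rule subfield_OmegaI) (auto intro: pi_1[OF s(1)] pi_add[OF s(1)] pi_mult[OF s(1)] pi_uminus[OF s(1)] pi_inverse[OF s(1)])
    then have s_fix: "adjoin K x \<subseteq> {z. (z, z) \<in> s}"
      using r_fix Ka(2) s(2,3) by (intro adjoin_least) auto
    obtain t where t: "partial_iso t" "s \<subseteq> t" "Domain t = alg_cl (Domain s)" "\<And>z w. (z, w) \<in> t \<Longrightarrow> v z = v w"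
      using value_preserving_extension[OF s(1,4)] by blast
    have "adjoin K x \<subseteq> Domain s" using s_fix by blast
    then have Dt: "Domain t = alg_cl (adjoin K x)" using alg_cl_mono closure t(3) by (metis top.extremum_uniqueI)
    have "Id_on (adjoin K x) \<subseteq> t" using s_fix t(2) by blast
    then obtain \<tau> where \<tau>: "\<tau> \<in> Gal (adjoin K x)" "\<And>z w. (z, w) \<in> t \<Longrightarrow> \<tau> z = w"
      using Gal_of_partial_iso[OF subfield_adjoin t(1) _ Dt] by metis
    have "v (\<tau> z) = v z" for z
    proof -
      obtain w where w: "(z, w) \<in> t" using Dt closure by blast
      then show ?thesis using \<tau>(2)[OF w] t(4)[OF w] by simp
    qed
    then have "\<tau> y = y" using fixed \<tau>(1) by blast
    moreover have "(y, \<sigma> y) \<in> t" using y(1) s(2) t(2) by (auto simp: r_def)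
    ultimately show ?thesis using \<tau>(2) by metis
  qed
  ultimately show "y \<in> henselization v (adjoin K a)" by (simp add: henselization_def)
qed

text \<open>
  Here the minimality of the degree of \<open>a\<close> is used: the roots of the polynomial of small degree that represents
  \<open>z\<close> are farther from \<open>a\<close> than \<open>\<sigma> a\<close> is.
\<close>

lemma close_on_adjoin:
  assumes \<sigma>: "\<sigma> \<in> Gal (adjoin K x)" and v\<sigma>: "\<And>z. v (\<sigma> z) = v z" and z: "z \<in> adjoin K a"
  shows "close z (\<sigma> z)"
proof -
  define r where "r = {(z, \<sigma> z) | z. z \<in> UNIV}"
  have r: "partial_iso r"
    unfolding r_def using Gal_graph_alg_cl[OF subfield_adjoin \<sigma>] closure by simp
  have r_fix: "(z, z) \<in> r" if "z \<in> adjoin K x" for z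
    using that Gal_fixes[OF subfield_adjoin \<sigma>] by (force simp: r_def)
  have ra: "(a, \<sigma> a) \<in> r" by (auto simp: r_def)
  have "(x - a, x - \<sigma> a) \<in> r" by (rule pi_diff[OF r r_fix[OF adjoin_mem] ra])
  then have "v (x - \<sigma> a) = Fin \<gamma>" using v\<sigma> v_x_a by (auto simp: r_def)
  then have moved: "Fin \<gamma> \<le> v (\<sigma> a - a)"
    using v_diff_ge[of "Fin \<gamma>" "x - a" "x - \<sigma> a"] v_x_a by simp
  obtain f where f: "f \<in> polys K" "f = 0 \<or> degree f < degree (min_poly K a)" "z = poly f a"
    using adjoin_alg_reduced[OF K a z] by blast
  have "rel_poly r f f" using f(1) r_fix subsetD[OF adjoin_incl[of K x]] by (simp add: rel_poly_def polys_def)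
  then have "(poly f a, poly f (\<sigma> a)) \<in> r" by (rule rel_poly_poly[OF r _ ra])
  then have \<sigma>z: "\<sigma> z = poly f (\<sigma> a)" by (auto simp: r_def f(3))
  show ?thesis
  proof (cases "f = 0")
    case True
    then show ?thesis using \<sigma>z f(3) by (simp add: close_refl)
  next
    case False
    have "close (a - c) (\<sigma> a - c)" if c: "poly f c = 0" for c
    proof -
      have ca: "c \<in> alg_cl K" using c f(1) False alg_cl_iff[OF K] by blast
      have "degree (min_poly K c) < degree (min_poly K a)"
        using degree_min_poly_le[OF K ca f(1) False c] f(2) False by simp
      then have "v (a - c) < Fin \<gamma>" using minimal[OF ca] by (meson not_le)
      then show ?thesis using moved by (simp add: close_def less_le_trans)
    qed
    then show ?thesis
      unfolding \<sigma>z unfolding f(3) by (rule close_poly_of_roots)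
  qed
qed

text \<open>
  The restriction of \<open>\<sigma>\<close> to \<open>K(a)\<close> moves every element to a close one, so it is also the restriction of
  an element \<open>\<rho>\<close> of the ramification group of \<open>K\<close>.
\<close>

lemma ramified_part_fixed:
  assumes \<sigma>: "\<sigma> \<in> Gal (adjoin K x)" and v\<sigma>: "\<And>z. v (\<sigma> z) = v z"
    and z: "z \<in> adjoin K a" "z \<in> ramification_field v K"
  shows "\<sigma> z = z"
proof -
  define s where "s = {(z, \<sigma> z) | z. z \<in> adjoin K a}"
  have s: "partial_iso s"
    unfolding s_def using closure by (intro Gal_graph[OF subfield_adjoin \<sigma>] Ka(1)) simp
  have Ds: "Domain s = adjoin K a" by (auto simp: s_def)
  have "close z w" if "(z, w) \<in> s" for z w
    using that close_on_adjoin[OF \<sigma> v\<sigma>] by (auto simp: s_def)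
  then obtain t where t: "partial_iso t" "s \<subseteq> t" "Domain t = alg_cl K" "\<And>z w. (z, w) \<in> t \<Longrightarrow> close z w"
    using close_extension[OF s] Ds Ka(4) by metis
  have "Id_on K \<subseteq> s"
    using Ka(2) adjoin_incl[of K x] Gal_fixes[OF subfield_adjoin \<sigma>] by (force simp: s_def)
  then obtain \<rho> where \<rho>: "\<rho> \<in> Gal K" "\<And>z w. (z, w) \<in> t \<Longrightarrow> \<rho> z = w"
    using Gal_of_partial_iso[OF K t(1) _ t(3)] t(2) by blast
  have "v c < v (\<rho> c - c)" if c: "c \<in> sep_cl K - {0}" for c
  proof -
    obtain w where w: "(c, w) \<in> t" using c t(3) sep_cl_alg_cl by blast
    then have "close c (\<rho> c)" using t(4) \<rho>(2) by blast
    then show ?thesis using c by (auto simp: close_def v_less_Pinf_iff)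
  qed
  then have "\<rho> z = z" using z(2) \<rho>(1) by (simp add: ramification_field_def)
  moreover have "(z, \<sigma> z) \<in> t" using z(1) t(2) by (auto simp: s_def)
  ultimately show ?thesis using \<rho>(2) by metis
qed

text \<open>
  An automorphism in the decomposition group of \<open>K(x)\<close> fixes \<open>L\<close> pointwise and so restricts to one in the
  decomposition group of \<open>L\<close>.
\<close>

lemma implicit_constant_field_lower:
  "henselization v (adjoin K a \<inter> ramification_field v K) \<subseteq> implicit_constant_field v K x"
proof
  define L where "L = adjoin K a \<inter> ramification_field v K"
  have L: "subfield L \<Omega>" unfolding L_def by (intro subfield_Int Ka(1) subfield_ramification_field[OF K])
  have L_sep: "L \<subseteq> sep_cl K" by (auto simp: L_def ramification_field_def)
  have KL: "K \<subseteq> L"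
    using Ka(2) sep_cl_incl[OF K] Gal_fixes[OF K] by (auto simp: L_def ramification_field_def)
  fix y assume "y \<in> henselization v (adjoin K a \<inter> ramification_field v K)"
  then have y: "y \<in> sep_cl L" and fixed: "\<And>\<tau>. \<tau> \<in> Gal L \<Longrightarrow> \<forall>z\<in>sep_cl L. v (\<tau> z) = v z \<Longrightarrow> \<tau> y = y"
    by (auto simp: henselization_def L_def)
  have yK: "y \<in> sep_cl K" using sep_cl_tower[OF K L KL L_sep] y by blast
  have "\<sigma> y = y" if \<sigma>: "\<sigma> \<in> Gal (adjoin K x)" and "\<forall>z\<in>sep_cl (adjoin K x). v (\<sigma> z) = v z" for \<sigma>
  proof -
    have v\<sigma>: "v (\<sigma> z) = v z" for z
      using Gal_value_preserving[OF subfield_adjoin that] closure by blast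
    define r where "r = {(z, \<sigma> z) | z. z \<in> alg_cl L}"
    have r: "partial_iso r"
      unfolding r_def using closure by (intro Gal_graph[OF subfield_adjoin \<sigma>] subfield_alg_cl[OF L]) simp
    have "Domain r = alg_cl L" by (auto simp: r_def)
    moreover have "Id_on L \<subseteq> r"
    proof
      fix p assume "p \<in> Id_on L"
      then obtain z where z: "p = (z, z)" "z \<in> L" by blast
      then have "\<sigma> z = z" using ramified_part_fixed[OF \<sigma> v\<sigma>] by (simp add: L_def)
      then show "p \<in> r" using z alg_cl_incl[OF L] by (force simp: r_def)
    qed
    ultimately obtain \<tau> where \<tau>: "\<tau> \<in> Gal L" "\<And>z w. (z, w) \<in> r \<Longrightarrow> \<tau> z = w"
      using Gal_of_partial_iso[OF L r] by metis
    have \<tau>\<sigma>: "\<tau> z = \<sigma> z" if "z \<in> sep_cl L" for z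
      using that sep_cl_alg_cl by (intro \<tau>(2)) (auto simp: r_def)
    then have "\<tau> y = y" using fixed \<tau>(1) v\<sigma> by simp
    then show ?thesis using \<tau>\<sigma> y by simp
  qed
  moreover have "y \<in> sep_cl (adjoin K x)" using sep_cl_mono[OF K subfield_adjoin adjoin_incl] yK by blast
  ultimately show "y \<in> implicit_constant_field v K x"
    using yK sep_cl_alg_cl by (auto simp: implicit_constant_field_def henselization_def)
qed

end

theorem theorem1p3:
  fixes K :: "'a::alg_closed_field set"
    and x a :: 'a
    and v :: "'a \<Rightarrow> 'g::linordered_ab_group_add extended"
    and \<gamma> :: 'g
  assumes "subfield K \<Omega>"
    and "(ring.transcendental \<Omega> over K) x"
    and "algebraic_closure \<Omega> (adjoin K x)"
    and "valuation v"
    and "valuation_transcendental v K x"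
    and "minimal_pair v K x a \<gamma>"
  shows "henselization v (adjoin K a \<inter> ramification_field v K) \<subseteq> implicit_constant_field v K x
       \<and> implicit_constant_field v K x \<subseteq> henselization v (adjoin K a)"
proof -
  have "alg_cl (adjoin K x) = UNIV"
    using algebraic_closure.algebraic_extension[OF assms(3)] by (auto simp: alg_cl_def)
  moreover have "x \<notin> alg_cl K" using assms(2) by (simp add: alg_cl_def over_def)
  ultimately interpret minimal_pair_of_definition v K x a \<gamma>
    using assms by (intro minimal_pair_of_definition.intro valued_closed.intro valued.intro minimal_pair_of_definition_axioms.intro)
  show ?thesis using implicit_constant_field_lower implicit_constant_field_upper by blast
qed

end
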